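(* Assume that $\xi_p\in F$; that if $p=2$ and $n=1$ then $-1\in N_{K/F}(K^\times)$; and that we are not in the case ($p=2$ and $\omega=1<\nu$). Let $m\ge 1$ and let $(\mathbf a,d)$ be a minimal norm pair of length $m$. Then: (1) If $\omega<\nu$, then for every integer $\tilde d$ with $\tilde d\equiv d \pmod{p^\nu}$ (when $\nu=\infty$ this means $\tilde d=d$), the pair $(\mathbf a,\tilde d)$ is a minimal norm pair of length $m$. (2) If $\omega=\nu$, then $d\equiv 1\pmod{p^m}$. (3) $d\equiv \chi(\sigma)\pmod{p^{\min\{m,\nu\}}}$, where $\chi$ is the cyclotomic character of $K/F$.
   Context: Let $p$ be a prime, $n\ge1$, and $K/F$ a cyclic Galois extension of degree $p^n$ with $\mathrm{char}(K)\neq p$; $G=\mathrm{Gal}(K/F)=\langle\sigma\rangle$. For $0\le i\le n$ let $K_i$ be the intermediate field with $[K_i:F]=p^i$. For $k\ge1$, $\xi_{p^k}$ denotes a primitive $p^k$-th root of unity (in an algebraic closure) and $\mu_{p^k}$ the group of $p^k$-th roots of unity. Put $\omega=\infty$ if $\mu_{p^k}\subseteq F$ for all $k$, otherwise $\omega$ is the integer with $\mu_{p^\omega}\subseteq F$, $\mu_{p^{\omega+1}}\not\subseteq F$; define $\nu$ the same way with $K$ in place of $F$. $U_i=1+p^i\mathbb Z$, and $v_p$ is the $p$-adic valuation. Conventions: $-\infty$ is smaller than every integer, $-\infty+c=-\infty$, $p^{-\infty}=0$. Norm pair: for $m\ge1$, a pair $(\mathbf a,d)$ with $\mathbf a=(a_0,\dots,a_{m-1})\in\{-\infty,0,1,\dots,n\}^m$,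 $a_0<n$, and $d\in U_1$ is a norm pair of length $m$ if there exist $\alpha,\delta_m\in K^\times$ and $\delta_i\in K_{a_i}^\times$ for $0\le i<m$ (with $\delta_i=1$ when $a_i=-\infty$) such that $\sigma(\alpha)=\alpha^d\delta_0\delta_1^p\cdots\delta_m^{p^m}$ and $\xi_p=N_{K/F}(\alpha)^{(d-1)/p}\,N_{K_{n-1}/F}(\delta_0)\prod_{i=1}^m N_{K/F}(\delta_i)^{p^{i-1}}$ for a fixed primitive $p$-th root of unity $\xi_p$; one says $(\alpha,\{\delta_i\}_{i=0}^m)$ represents $(\mathbf a,d)$. Order: $(\mathbf a,d)\le(\mathbf a',d')$ if $\mathbf a<\mathbf a'$ lexicographically, or $\mathbf a=\mathbf a'$ and $\min\{v_p(d'-1),m\}\le\min\{v_p(d-1),m\}$. A norm pair of length $m$ is minimal if it is $\le$ every norm pair of length $m$. Cyclotomic character: $\chi(\sigma)$ is the element of $(\mathbb Z/p^\nu\mathbb Z)^\times$ (of $\mathbb Z_p^\times$ if $\nu=\infty$) with $\sigma(\zeta)=\zeta^{\chi(\sigma)}$ for all $\zeta\in\mu_{p^\nu}$ (all $p$-power roots of unity if $\nu=\infty$). *)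

theory Defs
  imports "HOL-Number_Theory.Number_Theory" "HOL-Library.Extended_Nat"
begin

(* K is the ambient field (a type 'a of class field); the cyclic Galois extension K/F of
   degree p^n is given by a field automorphism sigma of K of order exactly p^n, and
   F is its fixed field (Artin's theorem). *)

definition field_aut :: "('a::field \<Rightarrow> 'a) \<Rightarrow> bool" where
  "field_aut \<sigma> \<longleftrightarrow> bij \<sigma> \<and> (\<forall>x y. \<sigma> (x + y) = \<sigma> x + \<sigma> y) \<and> (\<forall>x y. \<sigma> (x * y) = \<sigma> x * \<sigma> y)"

(* intermediate field K_i with [K_i : F] = p^i: the fixed field of sigma^(p^i) *)
definition Kfix :: "('a::field \<Rightarrow> 'a) \<Rightarrow> nat \<Rightarrow> nat \<Rightarrow> 'a set" where
  "Kfix \<sigma> p i = {x. (\<sigma> ^^ (p ^ i)) x = x}"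

(* N_{K_i/F}(x) = prod_{j < p^i} sigma^j(x)  (for x in K_i) *)
definition normK :: "('a::field \<Rightarrow> 'a) \<Rightarrow> nat \<Rightarrow> nat \<Rightarrow> 'a \<Rightarrow> 'a" where
  "normK \<sigma> p i x = (\<Prod>j<p ^ i. (\<sigma> ^^ j) x)"

definition prim_root :: "'a::field \<Rightarrow> nat \<Rightarrow> bool" where
  "prim_root \<zeta> N \<longleftrightarrow> \<zeta> ^ N = 1 \<and> (\<forall>j. 0 < j \<and> j < N \<longrightarrow> \<zeta> ^ j \<noteq> 1)"

(* mu_{p^k} \<subseteq> S (roots of unity of order p^k, char \<noteq> p): S contains a primitive p^k-th root *)
definition has_roots :: "'a::field set \<Rightarrow> nat \<Rightarrow> nat \<Rightarrow> bool" where
  "has_roots S p k \<longleftrightarrow> (\<exists>\<zeta>\<in>S. prim_root \<zeta> (p ^ k))"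

definition root_level :: "'a::field set \<Rightarrow> nat \<Rightarrow> enat" where
  "root_level S p = (if (\<forall>k. has_roots S p k) then \<infinity>
      else enat (THE k. has_roots S p k \<and> \<not> has_roots S p (Suc k)))"

(* c \<equiv> chi(sigma) (mod p^k), for k \<le> nu: sigma(zeta) = zeta^c for all zeta in mu_{p^k} *)
definition cyc_char_cong :: "('a::field \<Rightarrow> 'a) \<Rightarrow> nat \<Rightarrow> nat \<Rightarrow> int \<Rightarrow> bool" where
  "cyc_char_cong \<sigma> p k c \<longleftrightarrow> (\<forall>\<zeta>::'a. \<zeta> ^ (p ^ k) = 1 \<longrightarrow> \<sigma> \<zeta> = \<zeta> powi c)"

(* entries of the vector a: None = -infinity, Some k = k *)
fun olt :: "nat option \<Rightarrow> nat option \<Rightarrow> bool" where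
  "olt None (Some _) = True"
| "olt (Some x) (Some y) = (x < y)"
| "olt _ _ = False"

definition lex_less :: "nat option list \<Rightarrow> nat option list \<Rightarrow> bool" where
  "lex_less a b \<longleftrightarrow> (\<exists>i < min (length a) (length b).
      (\<forall>j<i. a ! j = b ! j) \<and> olt (a ! i) (b ! i))"

(* min{v_p(x), m}, with v_p(0) = infinity *)
definition tval :: "nat \<Rightarrow> nat \<Rightarrow> int \<Rightarrow> nat" where
  "tval p m x = (if x = 0 then m else min (multiplicity (int p) x) m)"

definition pair_le :: "nat \<Rightarrow> nat \<Rightarrow> nat option list \<Rightarrow> int \<Rightarrow> nat option list \<Rightarrow> int \<Rightarrow> bool" where
  "pair_le p m a d a' d' \<longleftrightarrow> lex_less a a' \<or> (a = a' \<and> tval p m (d' - 1) \<le> tval p m (d - 1))"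

definition norm_pair :: "('a::field \<Rightarrow> 'a) \<Rightarrow> nat \<Rightarrow> nat \<Rightarrow> 'a \<Rightarrow> nat \<Rightarrow> nat option list \<Rightarrow> int \<Rightarrow> bool" where
  "norm_pair \<sigma> p n \<xi> m a d \<longleftrightarrow>
     m \<ge> 1 \<and> length a = m \<and>
     (\<forall>i<m. case a ! i of None \<Rightarrow> True | Some k \<Rightarrow> k \<le> n) \<and>
     (case a ! 0 of None \<Rightarrow> True | Some k \<Rightarrow> k < n) \<and>
     [d = 1] (mod int p) \<and>
     (\<exists>\<alpha> (\<delta>::nat \<Rightarrow> 'a). \<alpha> \<noteq> 0 \<and> \<delta> m \<noteq> 0 \<and>
        (\<forall>i<m. case a ! i of None \<Rightarrow> \<delta> i = 1
                             | Some k \<Rightarrow> \<delta> i \<noteq> 0 \<and> \<delta> i \<in> Kfix \<sigma> p k) \<and>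
        \<sigma> \<alpha> = \<alpha> powi d * (\<Prod>i\<le>m. \<delta> i ^ (p ^ i)) \<and>
        \<xi> = normK \<sigma> p n \<alpha> powi ((d - 1) div int p) * normK \<sigma> p (n - 1) (\<delta> 0)
             * (\<Prod>i\<in>{1..m}. normK \<sigma> p n (\<delta> i) ^ (p ^ (i - 1))))"

definition minimal_norm_pair :: "('a::field \<Rightarrow> 'a) \<Rightarrow> nat \<Rightarrow> nat \<Rightarrow> 'a \<Rightarrow> nat \<Rightarrow> nat option list \<Rightarrow> int \<Rightarrow> bool" where
  "minimal_norm_pair \<sigma> p n \<xi> m a d \<longleftrightarrow> norm_pair \<sigma> p n \<xi> m a d \<and>
     (\<forall>a' d'. norm_pair \<sigma> p n \<xi> m a' d' \<longrightarrow> pair_le p m a d a' d')"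

end

(* A p-th root z of the norm of alpha satisfies sigma z = e z, where e is the right-hand side of the
   second condition on a norm pair.  So e depends on alpha alone, and norm pairs only record how deep
   the quotient sigma(alpha) / alpha^d lies in the groups generated by the K_{a_i}^{p^i}.

   Let c be an exponent by which sigma acts on roots of unity, and p^i the exact power of p dividing
   d - c.  If p^{i+1} does not divide c^{p^n} - 1, then sigma^{p^n} = 1 already allows d to be replaced
   by c.  Otherwise, applying (sigma^{p^n} - c^{p^n}) / (sigma - c) to alpha and extracting p-power
   roots yields a root of unity R in K.  If a_t < n - (i - t) for all t, then R contradicts
   sigma R = R^c.  So some a_t is large, and d can be replaced by c by absorbing a norm of alpha into
   delta_t.  If moreover i < min(m, nu), then Hilbert 90, together with the fact that x^p is a norm
   from K_k only if x is a norm from K_{k-1}, allows one to lower the vector a.  Hence a minimal pair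
   has d = chi(sigma) modulo p^{min(m, nu)}, and exchanging d for c gives the other two claims. *)

theory Submission
  imports Defs "HOL-Computational_Algebra.Polynomial"
begin

text \<open>A \<open>p\<close>-th root in the multiplicative group is determined only up to a power
  of \<xi>, and this power is the very invariant at stake. Cancelling a factor \<open>p\<close> in
  an equation of the group would therefore lose it: quotients by \<open>p\<close> are written down
  explicitly as integer polynomials in \<sigma> (\<open>dnrm\<close>, \<open>nrm_sum\<close>), and
  powers of \<open>p\<close> are cancelled between integer coefficients. Additive notation makes
  these computations linear.

  The bound n - (i - t) is a count. The factor belonging to t brings the exponent p^t, and the
  twisted norm of an element of K_k gains another p^(n - k); a p^(i + 1)-th root can be written down
  as long as i + 1 does not exceed t + n - k.

  The prime 2 interferes twice. A geometric sum of p^r powers of c has valuation exactly r, which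
  for p = 2 uses that c is 1 modulo 4; the exclusion of \<omega> = 1 < \<nu> provides this. And for
  p = 2, n = 1 the \<open>p\<close>-th root of the norm of \<alpha> is under control only if the
  first entry of the vector is -infinity, which holds for a minimal pair because -1 is a
  norm.\<close>

text \<open>The group \<open>K\<^sup>\<times>\<close> in additive notation, with those facts of Galois theory that the proof uses.\<close>

locale cyclic_module = Modules.module scale
  for scale :: "int \<Rightarrow> 'g::ab_group_add \<Rightarrow> 'g" (infixr \<open>*s\<close> 75) +
  fixes \<sigma> :: "'g \<Rightarrow> 'g" and p n :: nat and \<xi> :: 'g
  assumes p: "prime p" and n: "n \<ge> 1"
    and sig_add: "\<sigma> (x + y) = \<sigma> x + \<sigma> y"
    and sig_ord: "\<sigma> ^^ (p ^ n) = id"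
    and xi_tor: "int p *s \<xi> = 0" and xi_nz: "\<xi> \<noteq> 0" and sig_xi: "\<sigma> \<xi> = \<xi>"
    and p_torsion: "int p *s x = 0 \<Longrightarrow> \<exists>j. x = j *s \<xi>"
    and hilbert90: "k \<le> n \<Longrightarrow> (\<Sum>j<p ^ (n - k). (\<sigma> ^^ (p ^ k * j)) x) = 0
      \<Longrightarrow> \<exists>y. x = (\<sigma> ^^ (p ^ k)) y - y"
begin

section \<open>Powers of \<sigma>, fixed subgroups, plain and twisted norms\<close>

lemmas scale_simps = scale_left_distrib scale_right_distrib scale_left_diff_distrib
  scale_right_diff_distrib

lemma p_pos: "p > 0" "int p > 0" "int p \<noteq> 0" "p \<ge> 2"
  using prime_gt_0_nat[OF p] prime_ge_2_nat[OF p] by auto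

lemma sigj_add: "(\<sigma> ^^ j) (x + y) = (\<sigma> ^^ j) x + (\<sigma> ^^ j) y"
  by (induction j) (simp_all add: sig_add)

lemma sigj_0 [simp]: "(\<sigma> ^^ j) 0 = 0"
  using sigj_add[of j 0 0] by simp

lemma sigj_minus: "(\<sigma> ^^ j) (- x) = - (\<sigma> ^^ j) x"
  using sigj_add[of j x "- x"] by (simp add: eq_neg_iff_add_eq_0 add.commute)

lemma sigj_diff: "(\<sigma> ^^ j) (x - y) = (\<sigma> ^^ j) x - (\<sigma> ^^ j) y"
  using sigj_add[of j x "- y"] by (simp add: sigj_minus)

lemma sigj_scale: "(\<sigma> ^^ j) (c *s x) = c *s (\<sigma> ^^ j) x"
proof (induction c rule: int_induct[of _ 0])
  case base then show ?case by simp
next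
  case (step1 i) then show ?case by (simp add: scale_left_distrib sigj_add)
next
  case (step2 i) then show ?case by (simp add: scale_left_diff_distrib sigj_diff)
qed

lemma sigj_sum: "(\<sigma> ^^ j) (\<Sum>i\<in>A. f i) = (\<Sum>i\<in>A. (\<sigma> ^^ j) (f i))"
  by (induction A rule: infinite_finite_induct) (simp_all add: sigj_add)

lemmas sigj_simps = sigj_add sigj_diff sigj_minus sigj_scale sigj_sum sigj_0
lemmas sig_simps = sigj_simps[of 1, simplified]

lemma sigj_comm: "(\<sigma> ^^ j) (\<sigma> x) = \<sigma> ((\<sigma> ^^ j) x)"
  by (metis funpow_swap1)

lemma sigj_sigj: "(\<sigma> ^^ i) ((\<sigma> ^^ j) x) = (\<sigma> ^^ (i + j)) x"
  by (simp add: funpow_add)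

definition fixd :: "nat \<Rightarrow> 'g set" where
  "fixd q = {x. (\<sigma> ^^ q) x = x}"

lemma fixd_1_iff: "x \<in> fixd (Suc 0) \<longleftrightarrow> \<sigma> x = x"
  by (simp add: fixd_def)

lemma fixd_closed [intro]:
  "0 \<in> fixd q" "x \<in> fixd q \<Longrightarrow> y \<in> fixd q \<Longrightarrow> x + y \<in> fixd q"
  "x \<in> fixd q \<Longrightarrow> y \<in> fixd q \<Longrightarrow> x - y \<in> fixd q"
  "x \<in> fixd q \<Longrightarrow> - x \<in> fixd q"
  "x \<in> fixd q \<Longrightarrow> c *s x \<in> fixd q" "x \<in> fixd q \<Longrightarrow> \<sigma> x \<in> fixd q"
  "x \<in> fixd q \<Longrightarrow> (\<sigma> ^^ j) x \<in> fixd q"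
  "(\<And>i. i \<in> I \<Longrightarrow> f i \<in> fixd q) \<Longrightarrow> (\<Sum>i\<in>I. f i) \<in> fixd q"
  by (auto simp: fixd_def sigj_simps sigj_comm) (metis add.commute sigj_sigj)

lemma fixd_mult: "x \<in> fixd q \<Longrightarrow> x \<in> fixd (q * s)"
  unfolding fixd_def by (induction s) (auto simp: funpow_add)

lemma fixd_mono: "x \<in> fixd (p ^ k) \<Longrightarrow> k \<le> l \<Longrightarrow> x \<in> fixd (p ^ l)"
  using fixd_mult[of x "p ^ k" "p ^ (l - k)"] by (simp flip: power_add)

lemma fixd_top [simp]: "x \<in> fixd (p ^ n)"
  by (simp add: fixd_def sig_ord)

text \<open>The operator \<open>(\<sigma>\<^sup>L - c\<^sup>L) / (\<sigma> - c)\<close>, evaluated by Horner's scheme.\<close>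

primrec tnrm :: "int \<Rightarrow> nat \<Rightarrow> 'g \<Rightarrow> 'g" where
  "tnrm c 0 x = 0"
| "tnrm c (Suc L) x = c *s tnrm c L x + (\<sigma> ^^ L) x"

definition nrm :: "nat \<Rightarrow> 'g \<Rightarrow> 'g" where
  "nrm L x = (\<Sum>j<L. (\<sigma> ^^ j) x)"

lemma nrm_eq_tnrm: "nrm L x = tnrm 1 L x"
  by (induction L) (simp_all add: nrm_def)

lemma nrm_simps0 [simp]: "nrm 0 x = 0" "nrm (Suc L) x = nrm L x + (\<sigma> ^^ L) x"
  by (simp_all add: nrm_def)

lemma tnrm_add: "tnrm c L (x + y) = tnrm c L x + tnrm c L y"
  by (induction L) (simp_all add: sigj_simps scale_simps algebra_simps)

lemma tnrm_scale: "tnrm c L (k *s x) = k *s tnrm c L x"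
  by (induction L) (simp_all add: sigj_simps scale_simps mult.commute)

lemma tnrm_0 [simp]: "tnrm c L 0 = 0"
  by (induction L) simp_all

lemma tnrm_minus: "tnrm c L (- x) = - tnrm c L x"
  using tnrm_scale[of c L "-1" x] by (simp add: scale_simps)

lemma tnrm_diff: "tnrm c L (x - y) = tnrm c L x - tnrm c L y"
  using tnrm_add[of c L x "- y"] by (simp add: tnrm_minus)

lemma tnrm_sum: "tnrm c L (\<Sum>i\<in>A. f i) = (\<Sum>i\<in>A. tnrm c L (f i))"
  by (induction A rule: infinite_finite_induct) (simp_all add: tnrm_add)

lemmas tnrm_simps = tnrm_add tnrm_diff tnrm_minus tnrm_scale tnrm_sum tnrm_0
lemmas nrm_simps = tnrm_simps[of 1, folded nrm_eq_tnrm]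

lemma tnrm_sigj: "tnrm c L ((\<sigma> ^^ j) x) = (\<sigma> ^^ j) (tnrm c L x)"
  by (induction L) (simp_all add: sigj_simps sigj_sigj add.commute)

lemma tnrm_fixd [intro]: "x \<in> fixd q \<Longrightarrow> tnrm c L x \<in> fixd q"
  by (induction L) auto

lemma sig_tnrm: "\<sigma> (tnrm c L x) = c *s tnrm c L x + (\<sigma> ^^ L) x - c ^ L *s x"
proof (induction L)
  case (Suc L)
  then show ?case unfolding tnrm.simps sig_simps Suc
    by (simp add: scale_simps algebra_simps)
qed (simp add: sig_simps)

lemma sig_nrm: "\<sigma> (nrm L x) = nrm L x + (\<sigma> ^^ L) x - x"
  using sig_tnrm[of 1 L x] by (simp add: nrm_eq_tnrm)

lemma tnrm_sig: "tnrm c L (\<sigma> x - c *s x) = (\<sigma> ^^ L) x - c ^ L *s x"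
  using tnrm_sigj[of c L 1 x] by (simp add: tnrm_simps sig_tnrm)

lemma nrm_sig: "nrm L (\<sigma> x - x) = (\<sigma> ^^ L) x - x"
  using tnrm_sig[of 1 L x] by (simp add: nrm_eq_tnrm)

lemma tnrm_add_length: "tnrm c (L + M) x = c ^ M *s tnrm c L x + (\<sigma> ^^ L) (tnrm c M x)"
  by (induction M) (simp_all add: sigj_simps sigj_sigj scale_simps algebra_simps)

text \<open>The quotient of X^(qs) - c^(qs) by X - c is the one of length q times a sum in X^q and
  c^q. On elements fixed by \<open>\<sigma> ^^ q\<close> that sum acts as an integer, a geometric
  sum in c^q, and this is where powers of \<open>p\<close> come from.\<close>

lemma tnrm_mult_length:
  assumes "x \<in> fixd q"
  shows "tnrm c (q * s) x = (\<Sum>l<s. (c ^ q) ^ l) *s tnrm c q x"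
proof (induction s)
  case (Suc s)
  have "(\<sigma> ^^ q) (tnrm c (q * s) x) = tnrm c (q * s) x"
    using tnrm_fixd[OF assms] by (simp add: fixd_def)
  then show ?case using Suc
    by (simp add: tnrm_add_length scale_simps power_mult algebra_simps)
qed simp

lemma nrm_mult_length: "x \<in> fixd q \<Longrightarrow> nrm (q * s) x = int s *s nrm q x"
  using tnrm_mult_length[of x q 1 s] by (simp add: nrm_eq_tnrm)

lemma nrm_level:
  assumes "x \<in> fixd (p ^ k)" "k \<le> l"
  shows "nrm (p ^ l) x = int p ^ (l - k) *s nrm (p ^ k) x"
  using nrm_mult_length[OF assms(1), of "p ^ (l - k)"] assms(2) by (simp flip: power_add)

lemma nrm_in_F: "x \<in> fixd q \<Longrightarrow> nrm q x \<in> fixd (Suc 0)"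
  by (simp add: fixd_1_iff sig_nrm) (simp add: fixd_def)

lemma sig_nrm_n [simp]: "\<sigma> (nrm (p ^ n) x) = nrm (p ^ n) x"
  using nrm_in_F[OF fixd_top, of x] by (simp add: fixd_1_iff)

lemma geo_shift: "c * (\<Sum>l<L. c ^ l) = (\<Sum>l<L. c ^ l) + c ^ L - (1::int)"
  by (induction L) (simp_all add: algebra_simps)

text \<open>The difference of twisted and plain norm for c = 1 + p g, divided by p as a polynomial
  in \<sigma>.\<close>

primrec dnrm :: "int \<Rightarrow> nat \<Rightarrow> 'g \<Rightarrow> 'g" where
  "dnrm g 0 x = 0"
| "dnrm g (Suc L) x = (1 + int p * g) *s dnrm g L x + g *s nrm L x"

lemma tnrm_eq_dnrm: "tnrm (1 + int p * g) L x = nrm L x + int p *s dnrm g L x"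
  by (induction L) (simp_all add: scale_simps algebra_simps)

text \<open>Formally this is \<open>sig_tnrm\<close> minus \<open>sig_nrm\<close>, divided by p. The
  group has p-torsion, so the formula is proved by induction and not by cancellation.\<close>

lemma sig_dnrm:
  assumes "c = 1 + int p * g"
  shows "\<sigma> (dnrm g L x) = c *s dnrm g L x + g *s nrm L x - (g * (\<Sum>l<L. c ^ l)) *s x"
proof (induction L)
  case (Suc L)
  have e: "g * (\<Sum>l<Suc L. c ^ l) = c * (g * (\<Sum>l<L. c ^ l)) + g"
    using arg_cong[OF geo_shift[of c L], of "\<lambda>t. g * t"] by (simp add: algebra_simps)
  show ?case
    unfolding e dnrm.simps assms[symmetric] sig_simps Suc sig_nrm
    by (simp add: scale_simps algebra_simps)
qed (simp add: sig_simps)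

text \<open>In multiplicative notation: the norm of \<open>x\<close> has a \<open>p\<close>-th root \<open>z\<close> with
  \<open>\<sigma> z = \<xi>\<^sup>j z\<close>. For \<open>j\<close> prime to \<open>p\<close> this says that the norm is a \<open>p\<close>-th power in \<open>K\<close>
  but not in \<open>F\<close>.\<close>

definition kummer_char :: "int \<Rightarrow> 'g \<Rightarrow> bool" where
  "kummer_char j x \<longleftrightarrow> (\<exists>z. int p *s z = nrm (p ^ n) x \<and> \<sigma> z = z + j *s \<xi>)"

lemma scale_xi_eq_0_iff: "j *s \<xi> = 0 \<longleftrightarrow> int p dvd j"
proof
  assume j: "j *s \<xi> = 0"
  show "int p dvd j"
  proof (rule ccontr)
    assume "\<not> int p dvd j"
    then have "coprime (int p) j" using p by (simp add: prime_imp_coprime)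
    then obtain u v where "u * int p + v * j = 1"
      by (metis bezout_int coprime_imp_gcd_eq_1)
    then have "\<xi> = (u * int p + v * j) *s \<xi>" by simp
    also have "\<dots> = u *s (int p *s \<xi>) + v *s (j *s \<xi>)" by (simp add: scale_simps)
    finally show False using j xi_tor xi_nz by simp
  qed
next
  assume "int p dvd j"
  then obtain i where "j = i * int p" by (metis dvdE mult.commute)
  then have "j *s \<xi> = i *s (int p *s \<xi>)" by (simp add: scale_simps)
  then show "j *s \<xi> = 0" by (simp add: xi_tor)
qed

lemma sig_scale_xi [simp]: "\<sigma> (j *s \<xi>) = j *s \<xi>"
  by (simp add: sig_simps sig_xi)

lemma kummer_char_combine:
  assumes "kummer_char i x" "kummer_char j y" shows "kummer_char (u * i + v * j) (u *s x + v *s y)"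
proof -
  obtain a b where *: "int p *s a = nrm (p ^ n) x" "\<sigma> a = a + i *s \<xi>"
    "int p *s b = nrm (p ^ n) y" "\<sigma> b = b + j *s \<xi>"
    using assms by (auto simp: kummer_char_def)
  then show ?thesis unfolding kummer_char_def
    by (intro exI[of _ "u *s a + v *s b"])
       (simp add: sig_simps nrm_simps scale_simps mult.commute[of "int p"] flip: *(1,3))
qed

lemma kummer_char_scale: "kummer_char i x \<Longrightarrow> kummer_char (u * i) (u *s x)"
  using kummer_char_combine[of i x i x u 0] by simp

lemma kummer_char_zeroI: "nrm (p ^ n) x = int p *s g \<Longrightarrow> \<sigma> g = g \<Longrightarrow> kummer_char 0 x"
  unfolding kummer_char_def by (intro exI[of _ g]) simp

section \<open>Explicit p-th roots of norms, and norm descent\<close>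

definition nrm_sum :: "nat \<Rightarrow> 'g \<Rightarrow> 'g" where "nrm_sum L x = (\<Sum>j<L. nrm j x)"

lemma nrm_sum_simps0 [simp]: "nrm_sum 0 x = 0" "nrm_sum (Suc L) x = nrm_sum L x + nrm L x"
  by (simp_all add: nrm_sum_def)

lemma sig_nrm_sum: "\<sigma> (nrm_sum L x) = nrm_sum L x + nrm L x - int L *s x"
proof (induction L)
  case (Suc L)
  show ?case unfolding nrm_sum_simps0 sig_simps Suc sig_nrm
    by (simp add: scale_simps algebra_simps)
qed (simp add: sig_simps)

lemma nrm_sum_add: "nrm_sum L (x + y) = nrm_sum L x + nrm_sum L y"
  by (simp add: nrm_sum_def nrm_simps sum.distrib)

lemma nrm_sum_scale: "nrm_sum L (c *s x) = c *s nrm_sum L x"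
  by (simp add: nrm_sum_def nrm_simps scale_sum_right)

text \<open>Each conjugate of b is b plus a partial norm of x; thus \<open>nrm_sum L\<close> is the
  quotient of \<open>nrm L\<close> - L by \<sigma> - 1.\<close>

lemma nrm_eq_nrm_sum:
  assumes "\<sigma> b = b + x"
  shows "nrm L b = int L *s b + nrm_sum L x"
proof -
  have j: "(\<sigma> ^^ j) b = b + nrm j x" for j
    using nrm_sig[of j b] assms by (simp add: algebra_simps)
  show ?thesis by (induction L) (simp_all add: j scale_simps algebra_simps)
qed

lemma nrm_add_length: "nrm (L + M) x = nrm L x + (\<sigma> ^^ L) (nrm M x)"
  using tnrm_add_length[of 1 L M x] by (simp add: nrm_eq_tnrm)

lemma nrm_sum_add_length:
  assumes "x \<in> fixd q"
  shows "nrm_sum (q + M) x = nrm_sum q x + nrm_sum M x + int M *s nrm q x"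
proof (induction M)
  case (Suc M)
  have "(\<sigma> ^^ q) (nrm M x) = nrm M x"
    using tnrm_fixd[OF assms] by (simp add: fixd_def nrm_eq_tnrm)
  then show ?case using Suc
    by (simp add: nrm_add_length scale_simps add.assoc add.left_commute)
qed simp

lemma nrm_sum_mult_length:
  assumes "x \<in> fixd q"
  shows "nrm_sum (q * s) x = int s *s nrm_sum q x + int (q * (s * (s - 1) div 2)) *s nrm q x"
proof (induction s)
  case 0 then show ?case by simp
next
  case (Suc s)
  have "Suc s * (Suc s - 1) div 2 = s * (s - 1) div 2 + s"
  proof -
    have "Suc s * (Suc s - 1) = s * (s - 1) + s * 2" by (cases s) simp_all
    then show ?thesis by simp
  qed
  then show ?case using Suc nrm_sum_add_length[OF assms, of "q * s"]
    by (simp add: scale_simps algebra_simps)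
qed

text \<open>Expanding the norm of b by \<open>nrm_eq_nrm_sum\<close>, each term carries a visible
  factor p except the one with coefficient q p (p - 1) / 2, where q = p^(n - 1). This coefficient is
  a multiple of p unless p = 2 and n = 1, when it equals 1; the assumption \<open>tame\<close> then
  makes x vanish.\<close>

lemma kummer_char_of_decomp:
  assumes b: "\<sigma> b = b + x + int p *s y" and x: "x \<in> fixd (p ^ (n - 1))"
    and tame: "odd p \<or> n \<ge> 2 \<or> x = 0"
  shows "\<exists>z. int p *s z = nrm (p ^ n) b \<and> \<sigma> z = z + nrm (p ^ (n - 1)) x + nrm (p ^ n) y"
proof -
  define q where "q = p ^ (n - 1)"
  have pq: "p ^ n = q * p" using n by (simp add: q_def flip: power_Suc2)
  obtain h where h: "int h *s nrm q x = int (q * (p * (p - 1) div 2)) *s nrm q x" "p dvd h"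
  proof (cases "x = 0")
    case True then show ?thesis by (intro that[of 0]) (simp_all add: nrm_simps)
  next
    case False
    have "p dvd q * (p * (p - 1) div 2)"
    proof (cases "odd p")
      case True
      then have "p * (p - 1) div 2 = p * ((p - 1) div 2)" by (simp add: div_mult_swap)
      then show ?thesis by simp
    next
      case F: False
      then have "n \<ge> 2" using tame False by auto
      then have "p dvd q" by (simp add: q_def)
      then show ?thesis by simp
    qed
    then show ?thesis using that by blast
  qed
  then obtain h' where h': "h = p * h'" by blast
  define z where "z = int q *s b + nrm_sum q x + int h' *s nrm q x + nrm_sum (p ^ n) y"
  have "nrm (p ^ n) b = int (p ^ n) *s b + nrm_sum (p ^ n) x + int p *s nrm_sum (p ^ n) y"
    using nrm_eq_nrm_sum[of b "x + int p *s y"] b by (simp add: nrm_sum_add nrm_sum_scale add.assoc)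
  also have "nrm_sum (p ^ n) x = int p *s nrm_sum q x + int p *s int h' *s nrm q x"
    using nrm_sum_mult_length[OF x[folded q_def], of p] h(1) unfolding pq by (simp add: h' scale_simps)
  finally have 1: "int p *s z = nrm (p ^ n) b"
    by (simp add: z_def pq scale_simps mult.commute)
  have "\<sigma> (nrm q x) = nrm q x" using nrm_in_F[of x q] x by (simp add: q_def fixd_1_iff)
  then have "\<sigma> z = z + nrm q x + nrm (p ^ n) y"
    by (simp add: z_def sig_simps b sig_nrm_sum pq scale_simps mult.commute algebra_simps)
  with 1 show ?thesis unfolding q_def by blast
qed

text \<open>Put q = p^(n - r). The partial norm \<open>nrm q y\<close> need not lie in F, but it
  differs from x by an element whose norm from K to K_(n - r) is trivial. Hilbert 90 writes this
  defect as a partial norm of some \<sigma> k - k. Once y is corrected accordingly its partial norm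
  is x, and the invariance of x puts the corrected element into K_(n - r).\<close>

lemma norm_descent:
  assumes x: "\<sigma> x = x" and g: "int p ^ r *s x = nrm (p ^ n) y" and r: "r \<le> n"
  shows "\<exists>l\<in>fixd (p ^ (n - r)). nrm (p ^ (n - r)) l = x"
proof -
  define q where "q = p ^ (n - r)"
  have pn: "p ^ n = q * p ^ r" using r by (simp add: q_def flip: power_add)
  have sx: "(\<sigma> ^^ j) x = x" for j using x by (induction j) auto
  have nn: "nrm (q * s) y = (\<Sum>j<s. (\<sigma> ^^ (q * j)) (nrm q y))" for s
  proof (induction s)
    case 0 show ?case by simp
  next
    case (Suc s)
    then show ?case using nrm_add_length[of "q * s" q y] by (simp add: add.commute)
  qed
  have "(\<Sum>j<p ^ r. (\<sigma> ^^ (q * j)) (nrm q y - x)) = nrm (p ^ n) y - int p ^ r *s x"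
    unfolding pn nn by (simp add: sigj_diff sum_subtractf sx flip: sum_constant_scale)
      (simp add: scale_simps sum_constant_scale)
  then have "(\<Sum>j<p ^ r. (\<sigma> ^^ (q * j)) (nrm q y - x)) = 0" using g by simp
  then obtain k where k: "nrm q y - x = (\<sigma> ^^ q) k - k"
    using hilbert90[of "n - r" "nrm q y - x"] r by (auto simp: q_def)
  define l where "l = y - (\<sigma> k - k)"
  have nl: "nrm q l = x" using k unfolding l_def nrm_simps(2)[of q y] nrm_sig by (metis diff_diff_eq2 add_diff_cancel_left')
  then have "(\<sigma> ^^ q) l = l" using sig_nrm[of q l] x by simp
  with nl show ?thesis unfolding q_def fixd_def by blast
qed

end

section \<open>Exact divisibility of geometric sums by powers of p\<close>

lemma geo_sum_int: "(c - 1) * (\<Sum>l<L. c ^ l) = c ^ L - (1::int)"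
  by (induction L) (simp_all add: algebra_simps)

lemma geo_sum_mult_length:
  "(\<Sum>l<q * s. c ^ l) = (\<Sum>l<q. c ^ l) * (\<Sum>l<s. (c ^ q) ^ l)" for c :: int
proof (induction s)
  case (Suc s)
  have "(\<Sum>l<q * s + r. c ^ l) = (\<Sum>l<q * s. c ^ l) + c ^ (q * s) * (\<Sum>l<r. c ^ l)" for r
    by (induction r) (simp_all add: algebra_simps power_add)
  from this[of q] show ?case using Suc
    by (simp add: algebra_simps power_mult)
qed simp

lemma sum_below_int: "2 * (\<Sum>s<L. int s) = int L * (int L - 1)"
  by (induction L) (simp_all add: algebra_simps)

text \<open>For odd p, modulo p^2 the power c^s is 1 + s (c - 1), and the sum of all s < p is a
  multiple of p. For p = 2 the sum is 1 + c, and half of it is odd because c is 1 modulo 4.\<close>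

lemma geo_sum_prime:
  fixes c :: int
  assumes p: "prime p" and c: "[c = 1] (mod int p)" and four: "p = 2 \<Longrightarrow> [c = 1] (mod 4)"
  shows "\<exists>w. (\<Sum>s<p. c ^ s) = int p * w \<and> [w = 1] (mod int p)"
proof (cases "p = 2")
  case True
  obtain e where e: "c = 1 + 4 * e" using four[OF True]
    by (metis cong_iff_lin cong_sym mult.commute)
  have "(\<Sum>s<p. c ^ s) = int p * (1 + 2 * e)" by (simp add: True e numeral_2_eq_2)
  moreover have "[1 + 2 * e = 1] (mod int p)" by (simp add: True cong_def)
  ultimately show ?thesis by blast
next
  case False
  then have odd: "odd p" using p prime_odd_nat prime_ge_2_nat by (metis le_neq_implies_less)
  obtain g where g: "c = 1 + int p * g" using c by (metis cong_iff_lin cong_sym)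
  have "\<exists>y. c ^ s = 1 + int s * (int p * g) + int p * int p * y" for s
  proof (induction s)
    case 0 show ?case by (intro exI[of _ 0]) simp
  next
    case (Suc s)
    then obtain y where "c ^ s = 1 + int s * (int p * g) + int p * int p * y" by blast
    then show ?case
      by (intro exI[of _ "y + int s * g * g + int p * g * y"]) (simp add: g algebra_simps)
  qed
  then obtain y where y: "\<And>s. c ^ s = 1 + int s * (int p * g) + int p * int p * y s" by metis
  obtain h where h: "p = 2 * h + 1" using odd by (metis oddE)
  have "2 * (\<Sum>s<p. int s) = 2 * (int p * int h)"
    using sum_below_int[of p] by (simp add: h algebra_simps)
  then have s: "(\<Sum>s<p. int s) = int p * int h" by simp
  have "(\<Sum>s<p. c ^ s) = int p + (\<Sum>s<p. int s) * (int p * g) + int p * int p * (\<Sum>s<p. y s)"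
    unfolding y sum.distrib by (simp add: sum_distrib_left sum_distrib_right)
  also have "\<dots> = int p * (1 + int p * (int h * g + (\<Sum>s<p. y s)))"
    unfolding s by (simp add: algebra_simps)
  finally show ?thesis
    by (intro exI[of _ "1 + int p * (int h * g + (\<Sum>s<p. y s))"]) (simp add: cong_def)
qed

lemma geo_sum_prime_power:
  fixes c :: int
  assumes p: "prime p" and c: "[c = 1] (mod int p)" and four: "p = 2 \<Longrightarrow> [c = 1] (mod 4)"
  shows "\<exists>w. (\<Sum>s<p ^ r. c ^ s) = int p ^ r * w \<and> [w = 1] (mod int p)"
proof (induction r)
  case 0 show ?case by (intro exI[of _ 1]) simp
next
  case (Suc r)
  then obtain w where w: "(\<Sum>s<p ^ r. c ^ s) = int p ^ r * w" "[w = 1] (mod int p)" by blast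
  have "[c ^ p ^ r = 1] (mod int p)" "p = 2 \<Longrightarrow> [c ^ p ^ r = 1] (mod 4)"
    using cong_pow[OF c, of "p ^ r"] cong_pow[OF four, of "p ^ r"] by simp_all
  then obtain v where v: "(\<Sum>s<p. (c ^ p ^ r) ^ s) = int p * v" "[v = 1] (mod int p)"
    using geo_sum_prime[OF p] by blast
  have "(\<Sum>s<p ^ Suc r. c ^ s) = int p ^ Suc r * (w * v)"
    using geo_sum_mult_length[of c "p ^ r" p] w v by (simp add: mult.commute mult.left_commute)
  moreover have "[w * v = 1] (mod int p)" using cong_mult[OF w(2) v(2)] by simp
  ultimately show ?case by blast
qed

section \<open>Norm pairs in additive notation, and the root of unity attached to them\<close>

context cyclic_module
begin

definition has_levels :: "nat \<Rightarrow> nat option list \<Rightarrow> (nat \<Rightarrow> 'g) \<Rightarrow> bool" where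
  "has_levels m a \<delta> \<longleftrightarrow> (\<forall>i<m. case a ! i of None \<Rightarrow> \<delta> i = 0 | Some k \<Rightarrow> \<delta> i \<in> fixd (p ^ k))"

definition wsum :: "nat \<Rightarrow> (nat \<Rightarrow> 'g) \<Rightarrow> 'g" where
  "wsum m \<delta> = (\<Sum>i\<le>m. int p ^ i *s \<delta> i)"

definition admissible_vec :: "nat \<Rightarrow> nat option list \<Rightarrow> bool" where
  "admissible_vec m a \<longleftrightarrow> m \<ge> 1 \<and> length a = m \<and>
     (\<forall>i<m. \<forall>k. a ! i = Some k \<longrightarrow> k \<le> n) \<and> (\<forall>k. a ! 0 = Some k \<longrightarrow> k < n)"

definition add_norm_pair :: "nat \<Rightarrow> nat option list \<Rightarrow> int \<Rightarrow> bool" where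
  "add_norm_pair m a d \<longleftrightarrow> admissible_vec m a \<and> [d = 1] (mod int p) \<and>
     (\<exists>\<alpha> \<delta>. has_levels m a \<delta> \<and> \<sigma> \<alpha> = d *s \<alpha> + wsum m \<delta> \<and>
       \<xi> = ((d - 1) div int p) *s nrm (p ^ n) \<alpha> + nrm (p ^ (n - 1)) (\<delta> 0)
           + (\<Sum>i\<in>{1..m}. int p ^ (i - 1) *s nrm (p ^ n) (\<delta> i)))"

text \<open>For \<open>p = 2\<close> and \<open>n = 1\<close> an entry \<open>a\<^sub>0 = 0\<close> must be excluded: there the second condition on a
  norm pair depends on the chosen \<open>\<delta>\<^sub>i\<close> and not only on \<open>\<alpha>\<close>.\<close>

definition tame :: "nat option list \<Rightarrow> bool" where
  "tame a \<longleftrightarrow> odd p \<or> n \<ge> 2 \<or> a ! 0 = None"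

lemma wsum_split: "wsum m \<delta> = \<delta> 0 + int p *s (\<Sum>i\<in>{1..m}. int p ^ (i - 1) *s \<delta> i)"
  by (simp add: wsum_def sum.atMost_shift sum.atLeast1_atMost_eq scale_sum_right)

lemma wsum_add: "wsum m (\<lambda>i. f i + g i) = wsum m f + wsum m g"
  by (simp add: wsum_def scale_simps sum.distrib)

lemma wsum_scale: "wsum m (\<lambda>i. c *s f i) = c *s wsum m f"
  by (simp add: wsum_def scale_sum_right mult.commute)

lemma wsum_tnrm: "wsum m (\<lambda>i. tnrm c L (f i)) = tnrm c L (wsum m f)"
  by (simp add: wsum_def tnrm_simps)

lemma wsum_single: "i \<le> m \<Longrightarrow> wsum m (\<lambda>k. if k = i then x else 0) = int p ^ i *s x"
  by (simp add: wsum_def if_distrib[of "scale _"] cong: if_cong)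

lemma has_levels_add: "has_levels m a f \<Longrightarrow> has_levels m a g \<Longrightarrow> has_levels m a (\<lambda>i. f i + g i)"
  unfolding has_levels_def by (force split: option.splits)

lemma has_levels_scale: "has_levels m a f \<Longrightarrow> has_levels m a (\<lambda>i. c *s f i)"
  unfolding has_levels_def by (force split: option.splits)

lemma has_levels_tnrm: "has_levels m a f \<Longrightarrow> has_levels m a (\<lambda>i. tnrm c L (f i))"
  unfolding has_levels_def by (force split: option.splits)

lemma has_levels_single:
  assumes "i < m \<Longrightarrow> \<exists>k. a ! i = Some k \<and> x \<in> fixd (p ^ k)"
  shows "has_levels m a (\<lambda>t. if t = i then x else 0)"
  using assms unfolding has_levels_def by (auto split: option.splits)

lemma has_levels_first:
  assumes "admissible_vec m a" "has_levels m a \<delta>"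
  shows "\<delta> 0 \<in> fixd (p ^ (n - 1))" "a ! 0 = None \<Longrightarrow> \<delta> 0 = 0"
proof -
  have m: "0 < m" using assms by (auto simp: admissible_vec_def)
  show "a ! 0 = None \<Longrightarrow> \<delta> 0 = 0" using assms m by (auto simp: has_levels_def)
  show "\<delta> 0 \<in> fixd (p ^ (n - 1))"
  proof (cases "a ! 0")
    case None then show ?thesis using assms m fixd_closed(1) by (auto simp: has_levels_def)
  next
    case (Some k)
    then have "k \<le> n - 1" using assms by (auto simp: admissible_vec_def)
    moreover have "\<delta> 0 \<in> fixd (p ^ k)" using Some assms m by (auto simp: has_levels_def)
    ultimately show ?thesis using fixd_mono by blast
  qed
qed

text \<open>The right-hand side of the second condition on a norm pair is the Kummer character of a \<open>p\<close>-th
  root of the norm of \<open>\<alpha>\<close>, and hence does not involve \<open>d\<close> and the \<open>\<delta>\<^sub>i\<close>.\<close>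

lemma kummer_char_of_rep:
  assumes a: "admissible_vec m a" "tame a" and d: "[d = 1] (mod int p)"
    and \<delta>: "has_levels m a \<delta>" and rep: "\<sigma> \<alpha> = d *s \<alpha> + wsum m \<delta>"
  shows "\<exists>z. int p *s z = nrm (p ^ n) \<alpha> \<and>
    \<sigma> z = z + (((d - 1) div int p) *s nrm (p ^ n) \<alpha> + nrm (p ^ (n - 1)) (\<delta> 0)
           + (\<Sum>i\<in>{1..m}. int p ^ (i - 1) *s nrm (p ^ n) (\<delta> i)))"
proof -
  let ?e = "(d - 1) div int p"
  let ?y = "?e *s \<alpha> + (\<Sum>i\<in>{1..m}. int p ^ (i - 1) *s \<delta> i)"
  have dd: "d = 1 + int p * ?e" using d
    by (metis cong_iff_dvd_diff dvd_mult_div_cancel add_diff_cancel_left' diff_add_cancel add.commute)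
  have "\<sigma> \<alpha> = d *s \<alpha> + \<delta> 0 + int p *s (\<Sum>i\<in>{1..m}. int p ^ (i - 1) *s \<delta> i)"
    unfolding rep wsum_split by (simp add: add.assoc)
  also have "d *s \<alpha> = \<alpha> + int p *s ?e *s \<alpha>" by (subst dd) (simp add: scale_simps)
  finally have "\<sigma> \<alpha> = \<alpha> + \<delta> 0 + int p *s ?y" by (simp add: scale_simps algebra_simps)
  moreover have "odd p \<or> n \<ge> 2 \<or> \<delta> 0 = 0"
    using a has_levels_first(2)[OF a(1) \<delta>] by (auto simp: tame_def)
  ultimately obtain z where "int p *s z = nrm (p ^ n) \<alpha>"
      "\<sigma> z = z + nrm (p ^ (n - 1)) (\<delta> 0) + nrm (p ^ n) ?y"
    using kummer_char_of_decomp[of \<alpha> "\<delta> 0" ?y] has_levels_first(1)[OF a(1) \<delta>] by blast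
  then show ?thesis by (intro exI[of _ z]) (simp add: nrm_simps algebra_simps)
qed

text \<open>Any nontrivial Kummer character will do, since multiplying \<alpha> and all \<delta> by
  an inverse of j modulo p normalises it to \<xi>. In this form \<open>d\<close> and \<delta> occur
  only in the equation for \<open>\<sigma> \<alpha>\<close>, so pairs can be modified by checking
  that equation and the character of the new \<alpha>.\<close>

lemma add_norm_pair_iff:
  assumes "tame a"
  shows "add_norm_pair m a d \<longleftrightarrow> admissible_vec m a \<and> [d = 1] (mod int p) \<and>
     (\<exists>\<alpha> \<delta> j. has_levels m a \<delta> \<and> \<sigma> \<alpha> = d *s \<alpha> + wsum m \<delta> \<and> kummer_char j \<alpha> \<and> \<not> int p dvd j)"
    (is "_ \<longleftrightarrow> ?R")
proof
  assume L: "add_norm_pair m a d"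
  then obtain \<alpha> \<delta> where *: "admissible_vec m a" "[d = 1] (mod int p)" "has_levels m a \<delta>"
      "\<sigma> \<alpha> = d *s \<alpha> + wsum m \<delta>"
      "\<xi> = ((d - 1) div int p) *s nrm (p ^ n) \<alpha> + nrm (p ^ (n - 1)) (\<delta> 0)
           + (\<Sum>i\<in>{1..m}. int p ^ (i - 1) *s nrm (p ^ n) (\<delta> i))"
    unfolding add_norm_pair_def by blast
  have "kummer_char 1 \<alpha>" using kummer_char_of_rep[OF *(1) assms *(2,3,4)] unfolding *(5)[symmetric] by (simp add: kummer_char_def)
  moreover have "\<not> int p dvd 1" using p_pos by simp
  ultimately show ?R using * by blast
next
  assume ?R
  then obtain \<alpha> \<delta> j where *: "admissible_vec m a" "[d = 1] (mod int p)" "has_levels m a \<delta>"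
      "\<sigma> \<alpha> = d *s \<alpha> + wsum m \<delta>" "kummer_char j \<alpha>" "\<not> int p dvd j" by blast
  have "coprime j (int p)" using *(6) p by (simp add: coprime_commute[of j] prime_imp_coprime)
  then obtain u where u: "[j * u = 1] (mod int p)" by (metis cong_solve_coprime_int)
  define \<alpha>' where "\<alpha>' = u *s \<alpha>"
  define \<delta>' where "\<delta>' = (\<lambda>i. u *s \<delta> i)"
  define e where "e = ((d - 1) div int p) *s nrm (p ^ n) \<alpha>' + nrm (p ^ (n - 1)) (\<delta>' 0)
           + (\<Sum>i\<in>{1..m}. int p ^ (i - 1) *s nrm (p ^ n) (\<delta>' i))"
  have a: "has_levels m a \<delta>'" using has_levels_scale[OF *(3)] by (simp add: \<delta>'_def)
  have r: "\<sigma> \<alpha>' = d *s \<alpha>' + wsum m \<delta>'"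
    by (simp add: \<alpha>'_def \<delta>'_def wsum_scale sig_simps *(4) scale_simps mult.commute)
  obtain z where z: "int p *s z = nrm (p ^ n) \<alpha>'" "\<sigma> z = z + e"
    using kummer_char_of_rep[OF *(1) assms *(2) a r] unfolding e_def by blast
  obtain y where y: "int p *s y = nrm (p ^ n) \<alpha>'" "\<sigma> y = y + (u * j) *s \<xi>"
    using kummer_char_scale[OF *(5), of u] unfolding kummer_char_def \<alpha>'_def by blast
  \<comment> \<open>Two p-th roots of one norm differ by a multiple of \<xi>, which \<sigma> fixes,
    so both have the same character.\<close>
  obtain l where l: "y - z = l *s \<xi>" using p_torsion[of "y - z"] y z by (auto simp: scale_simps)
  have "\<sigma> (y - z) = y - z" unfolding l by simp
  then have "e = (u * j) *s \<xi>" using y z by (simp add: sig_simps algebra_simps)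
  moreover have "(u * j - 1) *s \<xi> = 0"
    unfolding scale_xi_eq_0_iff using u by (simp add: cong_iff_dvd_diff mult.commute)
  ultimately have "e = \<xi>" by (simp add: scale_simps)
  then show "add_norm_pair m a d" unfolding add_norm_pair_def using *(1,2) a r e_def by blast
qed

lemma add_norm_pair_I:
  assumes "tame a" "admissible_vec m a" "[d = 1] (mod int p)" "has_levels m a \<delta>"
    "\<sigma> \<alpha> = d *s \<alpha> + wsum m \<delta>" "kummer_char j \<alpha>" "\<not> int p dvd j"
  shows "add_norm_pair m a d"
  using add_norm_pair_iff[OF assms(1)] assms by blast

text \<open>The \<open>V\<^sub>t\<close> are formal \<open>p\<^sup>M\<close>-th roots of the twisted norms of the factors \<open>\<delta>\<^sub>t\<^bsup>p\<^sup>t\<^esup>\<close>; such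
  roots exist because an element of \<open>K\<^sub>k\<close> has a twisted norm divisible by \<open>p\<^bsup>n - k\<^esup>\<close>. Up to a
  multiple of the norm of \<open>\<alpha>\<close> their sum is a root of unity of order dividing \<open>p\<^sup>M\<close>.\<close>

lemma twisted_roots:
  assumes a: "admissible_vec m a" and \<delta>: "has_levels m a \<delta>"
    and c: "[c = 1] (mod int p)" "p = 2 \<Longrightarrow> [c = 1] (mod 4)"
    and M: "M \<le> m" "\<And>t k. t < m \<Longrightarrow> a ! t = Some k \<Longrightarrow> M + k \<le> t + n"
    and b: "c ^ p ^ n - 1 = int p ^ M * b"
    and rep: "\<sigma> \<alpha> = d *s \<alpha> + wsum m \<delta>"
  obtains V where
    "int p ^ M *s ((\<Sum>t\<le>m. V t) + b *s \<alpha>) = (c - d) *s tnrm c (p ^ n) \<alpha>"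
    "\<sigma> ((\<Sum>t\<le>m. V t) + b *s \<alpha>) = c *s ((\<Sum>t\<le>m. V t) + b *s \<alpha>) + (b * (d - c)) *s \<alpha>"
    "\<And>t. t < m \<Longrightarrow> \<forall>k. a ! t = Some k \<longrightarrow> M + k \<noteq> t + n \<Longrightarrow> \<exists>y. V t = int p *s y"
    "M < m \<Longrightarrow> \<exists>y. V m = int p *s y"
    "\<And>t k. t < m \<Longrightarrow> a ! t = Some k \<Longrightarrow> M + k = t + n
       \<Longrightarrow> \<exists>y. V t = nrm (p ^ k) (\<delta> t) + int p *s y"
proof -
  have ex: "\<exists>V. int p ^ M *s V = int p ^ t *s tnrm c (p ^ n) x \<and>
      \<sigma> V = c *s V - (int p ^ t * b) *s x \<and> (M + k \<noteq> t + n \<longrightarrow> (\<exists>y. V = int p *s y)) \<and>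
      (M + k = t + n \<longrightarrow> (\<exists>y. V = nrm (p ^ k) x + int p *s y))"
    if k: "k \<le> n" "M + k \<le> t + n" and x: "x \<in> fixd (p ^ k)" for t k x
  proof -
    have ck: "[c ^ p ^ k = 1] (mod int p)" "p = 2 \<Longrightarrow> [c ^ p ^ k = 1] (mod 4)"
      using cong_pow[OF c(1), of "p ^ k"] cong_pow[OF c(2), of "p ^ k"] by simp_all
    obtain w where w: "(\<Sum>s<p ^ (n - k). (c ^ p ^ k) ^ s) = int p ^ (n - k) * w"
        "[w = 1] (mod int p)"
      using geo_sum_prime_power[OF p ck] by blast
    \<comment> \<open>The exponent counts the factors p that remain: t from the weight, n - k from
      the twisted norm, minus the M extracted.\<close>
    define e where "e = int p ^ (t + n - k - M) * w"
    define Y where "Y = tnrm c (p ^ k) x"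
    have pn: "p ^ n = p ^ k * p ^ (n - k)" using k by (simp flip: power_add)
    have "tnrm c (p ^ n) x = (int p ^ (n - k) * w) *s Y"
      unfolding pn tnrm_mult_length[OF x] w Y_def ..
    moreover have pe: "int p ^ M * e = int p ^ t * (int p ^ (n - k) * w)"
      using k by (simp add: e_def flip: power_add mult.assoc)
    ultimately have 1: "int p ^ M *s (e *s Y) = int p ^ t *s tnrm c (p ^ n) x"
      by (simp add: scale_simps)
    have "(c ^ p ^ k - 1) * (int p ^ (n - k) * w) = int p ^ M * b"
      using geo_sum_int[of "c ^ p ^ k" "p ^ (n - k)"] b unfolding w pn by (simp add: power_mult)
    then have "int p ^ M * (e * (c ^ p ^ k - 1)) = int p ^ M * (int p ^ t * b)"
      using pe by (metis mult.assoc mult.commute)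
    \<comment> \<open>Here p^M is cancelled between integers, so that the formula for
      \<open>\<sigma> V\<close> holds exactly and not only up to a root of unity.\<close>
    then have eb: "e * (c ^ p ^ k - 1) = int p ^ t * b" using p_pos by simp
    have "\<sigma> Y = c *s Y - (c ^ p ^ k - 1) *s x"
      using x by (simp add: Y_def sig_tnrm fixd_def scale_simps)
    then have "\<sigma> (e *s Y) = c *s (e *s Y) - (e * (c ^ p ^ k - 1)) *s x"
      by (simp add: sig_simps scale_simps mult.commute right_diff_distrib)
    then have 2: "\<sigma> (e *s Y) = c *s (e *s Y) - (int p ^ t * b) *s x" by (simp add: eb)
    have 3: "\<exists>y. e *s Y = int p *s y" if "M + k \<noteq> t + n"
    proof -
      have "t + n - k - M = Suc (t + n - k - M - 1)" using that k by simp
      then have "e = int p * (int p ^ (t + n - k - M - 1) * w)"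
        unfolding e_def by (metis power_Suc mult.assoc)
      then show ?thesis by (metis scale_scale)
    qed
    have 4: "\<exists>y. e *s Y = nrm (p ^ k) x + int p *s y" if "M + k = t + n"
    proof -
      have "t + n - k - M = 0" using that by simp
      then have e: "e = w" by (simp add: e_def)
      obtain v where v: "w = 1 + int p * v" using w(2) by (metis cong_iff_lin cong_sym)
      obtain g where g: "c = 1 + int p * g" using c(1) by (metis cong_iff_lin cong_sym)
      have "e *s Y = nrm (p ^ k) x + int p *s (dnrm g (p ^ k) x + v *s Y)"
        using tnrm_eq_dnrm[of g "p ^ k" x] by (simp add: e v Y_def g scale_simps distrib_left distrib_right mult_ac)
      then show ?thesis by blast
    qed
    show ?thesis using 1 2 3 4 by blast
  qed
  let ?P = "\<lambda>t V. int p ^ M *s V = int p ^ t *s tnrm c (p ^ n) (\<delta> t) \<and>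
      \<sigma> V = c *s V - (int p ^ t * b) *s \<delta> t \<and>
      (t < m \<and> (\<forall>k. a ! t = Some k \<longrightarrow> M + k \<noteq> t + n) \<longrightarrow> (\<exists>y. V = int p *s y)) \<and>
      (t = m \<and> M < m \<longrightarrow> (\<exists>y. V = int p *s y)) \<and>
      (\<forall>k. t < m \<and> a ! t = Some k \<and> M + k = t + n \<longrightarrow> (\<exists>y. V = nrm (p ^ k) (\<delta> t) + int p *s y))"
  have "\<exists>V. ?P t V" if "t \<le> m" for t
  proof (cases "t = m")
    case True
    \<comment> \<open>The last factor may be any element of K, hence it is treated as one of level
      n.\<close>
    then show ?thesis using ex[of n t "\<delta> t"] M(1) by fastforce
  next
    case False
    then have tm: "t < m" using that by simp
    show ?thesis
    proof (cases "a ! t")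
      case None
      then have "\<delta> t = 0" using \<delta> tm by (auto simp: has_levels_def)
      then have "?P t 0" using None tm by (auto simp: sig_simps intro!: exI[of _ 0])
      then show ?thesis by blast
    next
      case (Some k)
      have "k \<le> n" using a tm Some by (auto simp: admissible_vec_def)
      moreover have "\<delta> t \<in> fixd (p ^ k)" using \<delta> tm Some by (auto simp: has_levels_def)
      ultimately show ?thesis using ex[of k t "\<delta> t"] M(2)[OF tm Some] tm Some by fastforce
    qed
  qed
  then obtain V where V: "\<And>t. t \<le> m \<Longrightarrow> ?P t (V t)" by metis
  let ?T = "tnrm c (p ^ n)"
  have "wsum m \<delta> = (\<sigma> \<alpha> - c *s \<alpha>) + (c - d) *s \<alpha>" by (simp add: rep scale_simps)
  then have "?T (wsum m \<delta>) = (1 - c ^ p ^ n) *s \<alpha> + (c - d) *s ?T \<alpha>"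
    by (simp only: tnrm_add tnrm_sig tnrm_scale) (simp add: sig_ord scale_simps)
  then have Tw: "?T (wsum m \<delta>) = (c - d) *s ?T \<alpha> - (int p ^ M * b) *s \<alpha>"
    by (simp add: scale_simps flip: b)
  have "int p ^ M *s (\<Sum>t\<le>m. V t) = ?T (wsum m \<delta>)"
    unfolding wsum_def tnrm_sum scale_sum_right tnrm_scale using V by (intro sum.cong) auto
  then have 1: "int p ^ M *s ((\<Sum>t\<le>m. V t) + b *s \<alpha>) = (c - d) *s ?T \<alpha>"
    by (simp add: Tw scale_simps)
  have "\<sigma> (\<Sum>t\<le>m. V t) = (\<Sum>t\<le>m. c *s V t - b *s (int p ^ t *s \<delta> t))"
    unfolding sig_simps using V by (intro sum.cong) (auto simp: mult.commute)
  also have "\<dots> = c *s (\<Sum>t\<le>m. V t) - b *s wsum m \<delta>"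
    by (simp only: sum_subtractf scale_sum_right wsum_def)
  finally have 2: "\<sigma> ((\<Sum>t\<le>m. V t) + b *s \<alpha>) =
      c *s ((\<Sum>t\<le>m. V t) + b *s \<alpha>) + (b * (d - c)) *s \<alpha>"
    by (simp add: sig_simps rep scale_simps right_diff_distrib mult.commute)
  show thesis by (rule that[of V]) (use 1 2 V in auto)
qed

text \<open>Adding \<open>dnrm\<close> turns a p-th root of the norm of \<alpha> into one of its
  twisted norm, and the character of \<alpha> survives as the deviation of \<sigma> from
  multiplication by c, apart from a multiple of \<alpha>.\<close>

lemma twisted_norm_root:
  assumes c: "c = 1 + int p * g" and z: "int p *s z = nrm (p ^ n) \<alpha>" "\<sigma> z = z + j *s \<xi>"
    and b: "c ^ p ^ n - 1 = int p * b"
  obtains z' where "int p *s z' = tnrm c (p ^ n) \<alpha>" "\<sigma> z' = c *s z' + j *s \<xi> - b *s \<alpha>"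
proof -
  define z' where "z' = z + dnrm g (p ^ n) \<alpha>"
  have gb: "g * (\<Sum>l<p ^ n. c ^ l) = b"
    using geo_sum_int[of c "p ^ n"] b p_pos by (simp add: c mult.assoc)
  have "int p *s z' = tnrm c (p ^ n) \<alpha>"
    unfolding c tnrm_eq_dnrm z'_def by (simp add: scale_right_distrib z)
  moreover have "\<sigma> z' = c *s z' + j *s \<xi> - b *s \<alpha>"
    unfolding z'_def sig_simps sig_dnrm[OF c] gb z(2) z(1)[symmetric]
    by (simp add: c scale_simps algebra_simps)
  ultimately show thesis using that by blast
qed

text \<open>Otherwise one obtains a \<open>p\<^bsup>i + 1\<^esup>\<close>-th root of unity \<open>R\<close> on which \<open>\<sigma>\<close> differs from the
  \<open>c\<close>-th power map by the nontrivial Kummer character of \<open>\<alpha>\<close>.\<close>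

lemma close_level_exists:
  assumes a: "admissible_vec m a" and \<delta>: "has_levels m a \<delta>"
    and rep: "\<sigma> \<alpha> = d *s \<alpha> + wsum m \<delta>" and e: "kummer_char j \<alpha>" "\<not> int p dvd j"
    and c: "[c = 1] (mod int p)" "p = 2 \<Longrightarrow> [c = 1] (mod 4)"
    and i: "i < m" "d - c = int p ^ i * u" "\<not> int p dvd u"
    and cn: "int p ^ Suc i dvd c ^ p ^ n - 1"
    and roots: "\<And>x. int p ^ Suc i *s x = 0 \<Longrightarrow> \<sigma> x = c *s x"
  shows "\<exists>t k. t < m \<and> a ! t = Some k \<and> t + n \<le> i + k"
proof (rule ccontr)
  assume neg: "\<not> ?thesis"
  obtain b where b: "c ^ p ^ n - 1 = int p ^ Suc i * b" using cn by blast
  obtain g where g: "c = 1 + int p * g" using c(1) by (metis cong_iff_lin cong_sym)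
  have M2: "Suc i + k \<le> t + n" if "t < m" "a ! t = Some k" for t k
  proof (rule ccontr)
    assume "\<not> Suc i + k \<le> t + n"
    then have "t + n \<le> i + k" by simp
    then show False using neg that by blast
  qed
  obtain V where V:
    "int p ^ Suc i *s ((\<Sum>t\<le>m. V t) + b *s \<alpha>) = (c - d) *s tnrm c (p ^ n) \<alpha>"
    "\<sigma> ((\<Sum>t\<le>m. V t) + b *s \<alpha>) = c *s ((\<Sum>t\<le>m. V t) + b *s \<alpha>) + (b * (d - c)) *s \<alpha>"
    by (rule twisted_roots[OF a \<delta> c Suc_leI[OF i(1)] M2 b rep])
  obtain z where z: "int p *s z = nrm (p ^ n) \<alpha>" "\<sigma> z = z + j *s \<xi>"
    using e(1) by (auto simp: kummer_char_def)
  have b': "c ^ p ^ n - 1 = int p * (int p ^ i * b)" using b by (simp add: mult.assoc)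
  obtain z' where z': "int p *s z' = tnrm c (p ^ n) \<alpha>"
      "\<sigma> z' = c *s z' + j *s \<xi> - (int p ^ i * b) *s \<alpha>"
    by (rule twisted_norm_root[OF g z b'])
  \<comment> \<open>As d - c = p^i u, the summand \<open>u *s z'\<close> serves twice: it makes R
    vanish under p^(i + 1), and it removes the multiple of \<alpha> from
    \<open>\<sigma> R - c *s R\<close>. What remains there is the character term.\<close>
  define R where "R = (\<Sum>t\<le>m. V t) + b *s \<alpha> + u *s z'"
  have "int p ^ Suc i *s R = (c - d) *s tnrm c (p ^ n) \<alpha> + (int p ^ i * u) *s (int p *s z')"
    unfolding R_def scale_right_distrib[of _ _ "u *s z'"] V(1) by (simp add: mult_ac)
  also have "\<dots> = 0" unfolding z'(1) i(2)[symmetric] by (simp add: scale_simps)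
  finally have "\<sigma> R = c *s R" by (rule roots)
  moreover have "\<sigma> R = c *s R + (u * j) *s \<xi>"
    unfolding R_def sig_simps(1)[of _ "u *s z'"] V(2) i(2)
    by (simp add: sig_simps z'(2) scale_simps mult_ac)
  ultimately have "(u * j) *s \<xi> = 0" by simp
  then have "int p dvd u * j" by (simp only: scale_xi_eq_0_iff)
  then show False using i(3) e(2) p by (metis prime_dvd_mult_iff prime_nat_int_transfer)
qed

end

section \<open>Changing the exponent while the vector stays fixed\<close>

lemma not_prime_power_dvd_cases:
  fixes x :: int
  assumes "\<not> q ^ m dvd x"
  obtains i u where "i < m" "x = q ^ i * u" "\<not> q dvd u"
proof -
  have "\<exists>i<m. \<exists>u. x = q ^ i * u \<and> \<not> q dvd u"
    using assms
  proof (induction m)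
    case (Suc m)
    show ?case
    proof (cases "q ^ m dvd x")
      case True
      then obtain u where u: "x = q ^ m * u" by blast
      then have "\<not> q dvd u" using Suc.prems by (auto simp: mult_ac)
      then show ?thesis using u by blast
    next
      case False
      then show ?thesis using Suc.IH less_SucI by blast
    qed
  qed simp
  then show thesis using that by blast
qed

lemma geo_sum_cong:
  fixes c :: int
  assumes "[c = 1] (mod q)"
  shows "[(\<Sum>l<L. c ^ l) = int L] (mod q)"
proof -
  have "[(\<Sum>l<L. c ^ l) = (\<Sum>l<L. 1)] (mod q)"
    using cong_pow[OF assms] by (intro cong_sum) simp
  then show ?thesis by simp
qed

lemma power_diff_dvd:
  fixes c d q :: int
  assumes "x dvd d - c" "[c = 1] (mod q)" "[d = 1] (mod q)" "q dvd int N"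
  shows "x * q dvd d ^ N - c ^ N"
proof -
  have "[(\<Sum>i<N. c ^ (N - Suc i) * d ^ i) = (\<Sum>i<N. 1)] (mod q)"
    using cong_mult[OF cong_pow[OF assms(2)] cong_pow[OF assms(3)]] by (intro cong_sum) simp
  then have "q dvd (\<Sum>i<N. c ^ (N - Suc i) * d ^ i)"
    using assms(4) by (simp add: cong_dvd_iff)
  then show ?thesis using assms(1) by (simp add: power_diff_sumr2 mult_dvd_mono)
qed

context cyclic_module
begin

lemma not_dvd_multI: "\<not> int p dvd x \<Longrightarrow> \<not> int p dvd y \<Longrightarrow> \<not> int p dvd x * y"
  using p by (metis prime_dvd_mult_iff prime_nat_int_transfer)

lemma cong_1_not_dvd: "[w = 1] (mod int p) \<Longrightarrow> \<not> int p dvd w"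
  using p_pos by (simp add: cong_dvd_iff)

lemma torsion_mono: "i \<le> m \<Longrightarrow> int p ^ i *s x = 0 \<Longrightarrow> int p ^ m *s x = 0"
  by (metis le_imp_power_dvd dvdE mult.commute scale_scale scale_zero_right)

text \<open>\<open>\<delta> m\<close> carries no level condition, so a multiple of p^m \<alpha> can
  be moved into it.\<close>

lemma add_norm_pair_shift_top:
  assumes "tame a" "add_norm_pair m a d" "int p ^ m dvd d - c"
  shows "add_norm_pair m a c"
proof -
  obtain \<alpha> \<delta> j where *: "admissible_vec m a" "[d = 1] (mod int p)" "has_levels m a \<delta>"
      "\<sigma> \<alpha> = d *s \<alpha> + wsum m \<delta>" "kummer_char j \<alpha>" "\<not> int p dvd j"
    using assms add_norm_pair_iff by blast
  obtain q where q: "d - c = int p ^ m * q" using assms(3) by blast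
  have "int p dvd d - c" using assms(3) *(1)
    by (metis admissible_vec_def dvd_power dvd_trans One_nat_def Suc_le_lessD)
  then have c: "[c = 1] (mod int p)" using *(2) by (metis cong_iff_dvd_diff cong_sym cong_trans)
  have "has_levels m a (\<lambda>t. \<delta> t + (if t = m then q *s \<alpha> else 0))"
    by (intro has_levels_add *(3) has_levels_single) simp
  moreover have "\<sigma> \<alpha> = c *s \<alpha> + wsum m (\<lambda>t. \<delta> t + (if t = m then q *s \<alpha> else 0))"
    unfolding wsum_add wsum_single[OF order_refl] *(4)
    using q by (simp add: scale_simps algebra_simps flip: q)
  ultimately show ?thesis using add_norm_pair_I[OF assms(1) *(1) c] *(5,6) by blast
qed

text \<open>Here \<open>\<sigma>\<^bsup>p\<^sup>n\<^esup> = 1\<close> turns \<open>\<alpha>\<close> to the power \<open>d\<^bsup>p\<^sup>n\<^esup> - 1\<close> into a product of admissible factors,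
  which absorbs a change of \<open>d\<close>.\<close>

lemma add_norm_pair_periodic:
  assumes "tame a" "add_norm_pair m a d" and c: "[c = 1] (mod int p)"
    and h: "int p ^ h dvd d - c" "d ^ p ^ n - 1 = int p ^ h * w" "\<not> int p dvd w"
  shows "add_norm_pair m a c"
proof -
  obtain \<alpha> \<delta> j where *: "admissible_vec m a" "[d = 1] (mod int p)" "has_levels m a \<delta>"
      "\<sigma> \<alpha> = d *s \<alpha> + wsum m \<delta>" "kummer_char j \<alpha>" "\<not> int p dvd j"
    using assms(1,2) add_norm_pair_iff by blast
  obtain q where q: "d - c = int p ^ h * q" using h(1) by blast
  let ?\<delta> = "\<lambda>i. w *s \<delta> i + (- q) *s tnrm d (p ^ n) (\<delta> i)"
  have "wsum m \<delta> = \<sigma> \<alpha> - d *s \<alpha>" by (simp add: *(4))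
  then have T: "tnrm d (p ^ n) (wsum m \<delta>) = - (int p ^ h * w) *s \<alpha>"
    by (simp add: tnrm_sig sig_ord scale_simps flip: h(2))
  have "has_levels m a ?\<delta>" by (intro has_levels_add has_levels_scale has_levels_tnrm *(3))
  moreover have "\<sigma> (w *s \<alpha>) = c *s (w *s \<alpha>) + wsum m ?\<delta>"
  proof -
    have "d = c + int p ^ h * q" using q by simp
    then show ?thesis
      unfolding wsum_add wsum_scale wsum_tnrm T
      by (simp add: sig_simps *(4) scale_simps distrib_left mult_ac)
  qed
  ultimately show ?thesis
    using add_norm_pair_I[OF assms(1) *(1) c] kummer_char_scale[OF *(5)] not_dvd_multI[OF h(3) *(6)] by blast
qed

lemma nrm_tnrm: "nrm L (tnrm c M x) = tnrm c M (nrm L x)"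
  by (simp add: nrm_def tnrm_simps tnrm_sigj)

lemma tnrm_F: "\<sigma> x = x \<Longrightarrow> tnrm c L x = (\<Sum>l<L. c ^ l) *s x"
  using tnrm_mult_length[of x 1 c L] by (simp add: fixd_def)

text \<open>Modulo \<open>\<sigma> - c\<close>, the power \<open>p\<^bsup>n - k\<^esup>\<close> of \<open>\<alpha>\<close> agrees up to a unit exponent with the norm of
  \<open>\<alpha>\<close> down to \<open>K\<^sub>k\<close>, which can be absorbed into \<open>\<delta>\<^sub>t\<close>.\<close>

lemma add_norm_pair_absorb:
  assumes a: "tame a" and np: "add_norm_pair m a d"
    and t: "t < m" "a ! t = Some k" and dc: "int p ^ (t + n - k) dvd d - c"
    and c: "[c = 1] (mod int p)" "p = 2 \<Longrightarrow> [c = 1] (mod 4)"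
  shows "add_norm_pair m a c"
proof -
  obtain \<alpha> \<delta> j where *: "admissible_vec m a" "has_levels m a \<delta>"
      "\<sigma> \<alpha> = d *s \<alpha> + wsum m \<delta>" "kummer_char j \<alpha>" "\<not> int p dvd j"
    using a np add_norm_pair_iff by blast
  have k: "k \<le> n" using *(1) t by (auto simp: admissible_vec_def)
  define r where "r = n - k"
  obtain q where "d - c = int p ^ (t + n - k) * q" using dc by blast
  then have q: "d - c = int p ^ t * int p ^ r * q" using k by (simp add: r_def flip: power_add)
  have pn: "p ^ k * p ^ r = p ^ n" using k by (simp add: r_def flip: power_add)
  have "[c ^ p ^ k = 1] (mod int p)" "p = 2 \<Longrightarrow> [c ^ p ^ k = 1] (mod 4)"
    using cong_pow[OF c(1), of "p ^ k"] cong_pow[OF c(2), of "p ^ k"] by simp_all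
  then obtain w where w: "(\<Sum>s<p ^ r. (c ^ p ^ k) ^ s) = int p ^ r * w" "[w = 1] (mod int p)"
    using geo_sum_prime_power[OF p] by blast
  \<comment> \<open>The sum of the operators (\<sigma>^l - c^l) / (\<sigma> - c) over the multiples
    l = p^k s, applied to \<alpha>. Hence \<open>\<sigma> \<kappa> - c *s \<kappa>\<close> is the
    norm N of \<alpha> to K_k minus p^r w \<alpha>.\<close>
  define \<kappa> where "\<kappa> = (\<Sum>s<p ^ r. tnrm c (p ^ k * s) \<alpha>)"
  define N where "N = (\<Sum>s<p ^ r. (\<sigma> ^^ (p ^ k * s)) \<alpha>)"
  have "(\<sigma> ^^ (p ^ k)) N + (\<sigma> ^^ (p ^ k * 0)) \<alpha> =
      (\<Sum>s<p ^ r. (\<sigma> ^^ (p ^ k * Suc s)) \<alpha>) + (\<sigma> ^^ (p ^ k * 0)) \<alpha>"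
    by (simp add: N_def sigj_sum sigj_sigj)
  also have "\<dots> = (\<Sum>s<Suc (p ^ r). (\<sigma> ^^ (p ^ k * s)) \<alpha>)"
    by (simp only: sum.lessThan_Suc_shift add.commute)
  also have "\<dots> = N + \<alpha>" by (simp add: N_def pn sig_ord)
  finally have N: "N \<in> fixd (p ^ k)" by (simp add: fixd_def)
  have "\<sigma> \<kappa> = (\<Sum>s<p ^ r. c *s tnrm c (p ^ k * s) \<alpha> + (\<sigma> ^^ (p ^ k * s)) \<alpha> - (c ^ p ^ k) ^ s *s \<alpha>)"
    by (simp add: \<kappa>_def sig_simps sig_tnrm power_mult)
  also have "\<dots> = c *s \<kappa> + N - (int p ^ r * w) *s \<alpha>"
    by (simp add: sum.distrib sum_subtractf \<kappa>_def N_def scale_sum_right flip: w(1) scale_sum_left)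
  finally have \<kappa>: "\<sigma> \<kappa> = c *s \<kappa> + N - (int p ^ r * w) *s \<alpha>" .
  define \<alpha>' where "\<alpha>' = w *s \<alpha> + 1 *s ((int p ^ t * q) *s \<kappa>)"
  define \<delta>' where "\<delta>' = (\<lambda>i. w *s \<delta> i + (if i = t then q *s N else 0))"
  have "has_levels m a \<delta>'"
    unfolding \<delta>'_def using t N by (intro has_levels_add has_levels_scale has_levels_single *(2)) auto
  moreover have "\<sigma> \<alpha>' = c *s \<alpha>' + wsum m \<delta>'"
  proof -
    have d: "d = c + int p ^ t * int p ^ r * q" using q by simp
    show ?thesis
      unfolding \<delta>'_def wsum_add wsum_scale wsum_single[OF less_imp_le[OF t(1)]]
      by (simp add: \<alpha>'_def sig_simps *(3) \<kappa> d scale_simps distrib_left mult_ac)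
  qed
  moreover have "kummer_char 0 ((int p ^ t * q) *s \<kappa>)"
  proof (cases t)
    case (Suc t')
    then show ?thesis
      by (intro kummer_char_zeroI[of _ "(int p ^ t' * q) *s nrm (p ^ n) \<kappa>"])
         (simp_all add: nrm_simps sig_simps mult.assoc)
  next
    case 0
    \<comment> \<open>For t = 0 no factor p^t makes the character of the correction vanish, so the
      norm of \<kappa> itself has to be a p-th power in F. Modulo p, B is p^n (p^r - 1) / 2; for p =
      2 its divisibility requires n at least 2, which \<open>tame\<close> gives because the first
      entry is not \<open>None\<close>.\<close>
    define B where "B = (\<Sum>s<p ^ r. \<Sum>l<p ^ k * s. c ^ l)"
    have "nrm (p ^ n) \<kappa> = B *s nrm (p ^ n) \<alpha>"
      by (simp add: \<kappa>_def nrm_simps nrm_tnrm tnrm_F B_def scale_sum_left)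
    moreover have "int p dvd B"
    proof -
      let ?S = "\<Sum>s<p ^ r. int (p ^ k * s)"
      have "2 * ?S = int p ^ k * (2 * (\<Sum>s<p ^ r. int s))" by (simp add: sum_distrib_left mult_ac)
      also have "\<dots> = int p ^ n * (int p ^ r - 1)"
        unfolding sum_below_int using pn by (simp add: mult.assoc[symmetric] flip: of_nat_mult of_nat_power)
      finally have S: "2 * ?S = int p ^ n * (int p ^ r - 1)" .
      have "int p dvd ?S"
      proof (cases "odd p")
        case True
        have "int p dvd 2 * ?S" unfolding S using n by (simp add: dvd_power)
        moreover have "\<not> int p dvd 2" using True p_pos(4)
          by (metis dvd_refl int_dvd_int_iff of_nat_numeral primes_dvd_imp_eq p two_is_prime_nat)
        ultimately show ?thesis using p by (metis prime_dvd_mult_iff prime_nat_int_transfer)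
      next
        case False
        then have p2: "p = 2" using p prime_odd_nat p_pos(4) by (metis le_neq_implies_less)
        have "n \<ge> 2" using a False 0 t by (auto simp: tame_def)
        then obtain n' where "n = Suc (Suc n')" by (metis add_2_eq_Suc le_Suc_ex)
        then have "2 * ?S = 2 * (2 * (2 ^ n' * (2 ^ r - 1)))" using S p2 by simp
        then have "?S = 2 * (2 ^ n' * (2 ^ r - 1))" by simp
        then show ?thesis using p2 by (metis dvd_triv_left of_nat_numeral)
      qed
      moreover have "[B = ?S] (mod int p)"
        unfolding B_def by (intro cong_sum geo_sum_cong c)
      ultimately show ?thesis by (simp add: cong_dvd_iff)
    qed
    then obtain B' where "B = int p * B'" by blast
    ultimately show ?thesis
      by (intro kummer_char_zeroI[of _ "(q * B') *s nrm (p ^ n) \<alpha>"])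
         (simp_all add: 0 nrm_simps sig_simps mult_ac)
  qed
  then have "kummer_char (w * j + 1 * 0) \<alpha>'" unfolding \<alpha>'_def by (intro kummer_char_combine *(4))
  moreover have "\<not> int p dvd w * j + 1 * 0"
    using not_dvd_multI[OF cong_1_not_dvd[OF w(2)] *(5)] by simp
  ultimately show ?thesis using add_norm_pair_I[OF a *(1) c(1)] by blast
qed

text \<open>This supplies the pairs with which a minimal pair is compared: every exponent describing
  \<sigma> on the p^m-torsion goes with the given vector, however far it is from d.\<close>

lemma add_norm_pair_cyclotomic:
  assumes a: "tame a" and np: "add_norm_pair m a d"
    and c: "[c = 1] (mod int p)" "p = 2 \<Longrightarrow> [c = 1] (mod 4)"
    and roots: "\<And>x. int p ^ m *s x = 0 \<Longrightarrow> \<sigma> x = c *s x"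
  shows "add_norm_pair m a c"
proof (cases "int p ^ m dvd d - c")
  case True
  then show ?thesis using add_norm_pair_shift_top[OF a np] by blast
next
  case False
  then obtain i u where i: "i < m" "d - c = int p ^ i * u" "\<not> int p dvd u"
    using not_prime_power_dvd_cases by blast
  obtain \<alpha> \<delta> j where *: "admissible_vec m a" "[d = 1] (mod int p)" "has_levels m a \<delta>"
      "\<sigma> \<alpha> = d *s \<alpha> + wsum m \<delta>" "kummer_char j \<alpha>" "\<not> int p dvd j"
    using a np add_norm_pair_iff by blast
  show ?thesis
  proof (cases "int p ^ Suc i dvd c ^ p ^ n - 1")
    case True
    have "\<sigma> x = c *s x" if "int p ^ Suc i *s x = 0" for x
      using roots torsion_mono[OF Suc_leI[OF i(1)] that] by blast
    then obtain t k where t: "t < m" "a ! t = Some k" "t + n \<le> i + k"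
      using close_level_exists[OF *(1,3,4,5,6) c i True] by blast
    have "int p ^ (t + n - k) dvd int p ^ i" using t by (intro le_imp_power_dvd) simp
    then have "int p ^ (t + n - k) dvd d - c" unfolding i(2) by simp
    then show ?thesis using add_norm_pair_absorb[OF a np t(1,2) _ c] by blast
  next
    case False
    then obtain h w where h: "h < Suc i" "c ^ p ^ n - 1 = int p ^ h * w" "\<not> int p dvd w"
      using not_prime_power_dvd_cases by blast
    \<comment> \<open>Since h is at most i, this shows that d^(p^n) - 1 and c^(p^n) - 1 contain the
      same power of p.\<close>
    have "int p ^ i * int p dvd d ^ p ^ n - c ^ p ^ n"
      using i(2) c(1) *(2) n by (intro power_diff_dvd) (simp_all add: dvd_power)
    then obtain e where e: "d ^ p ^ n - c ^ p ^ n = int p ^ i * int p * e" by blast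
    define l where "l = i - h"
    have il: "i = h + l" using h(1) by (simp add: l_def)
    have "d ^ p ^ n - 1 = int p ^ h * (w + int p ^ l * int p * e)"
      using e h(2) by (simp add: il power_add algebra_simps)
    moreover have "\<not> int p dvd w + int p ^ l * int p * e"
      using h(3) by (simp add: dvd_add_left_iff)
    moreover have "int p ^ h dvd d - c" unfolding i(2) il by (simp add: power_add)
    ultimately show ?thesis using add_norm_pair_periodic[OF a np c(1)] by blast
  qed
qed

end

section \<open>Lowering the vector of a pair whose exponent is not cyclotomic\<close>

context cyclic_module
begin

lemma wsum_split_at:
  assumes "t < m"
  shows "wsum m f = (\<Sum>i<t. int p ^ i *s f i) + int p ^ t *s f t
    + int p ^ Suc t *s (\<Sum>i\<in>{Suc t..m}. int p ^ (i - Suc t) *s f i)"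
proof -
  have "{..m} = {..<t} \<union> {t} \<union> {Suc t..m}" using assms by auto
  then have "wsum m f = (\<Sum>i<t. int p ^ i *s f i) + int p ^ t *s f t
      + (\<Sum>i\<in>{Suc t..m}. int p ^ i *s f i)"
    unfolding wsum_def by (simp add: sum.union_disjoint Int_Un_distrib2 disjoint_iff add_ac)
  moreover have "(\<Sum>i\<in>{Suc t..m}. int p ^ i *s f i) =
      int p ^ Suc t *s (\<Sum>i\<in>{Suc t..m}. int p ^ (i - Suc t) *s f i)"
    unfolding scale_sum_right scale_scale power_add[symmetric] by (intro sum.cong) auto
  ultimately show ?thesis by simp
qed

text \<open>Kummer theory: sending y to \<open>\<sigma> \<kappa> - \<kappa>\<close> embeds the
  classes of F modulo p-th powers that become p-th powers in K into the group generated by \<xi>.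
  The norm of \<alpha> has a nontrivial image as j is prime to p, hence it generates these
  classes.\<close>

lemma p_divisible_fixed:
  assumes "\<sigma> y = y" "y = int p *s \<kappa>" "kummer_char j \<alpha>" "\<not> int p dvd j"
  obtains l f where "\<sigma> f = f" "int p *s f = y - l *s nrm (p ^ n) \<alpha>"
proof -
  obtain z where z: "int p *s z = nrm (p ^ n) \<alpha>" "\<sigma> z = z + j *s \<xi>"
    using assms(3) by (auto simp: kummer_char_def)
  have "int p *s (\<sigma> \<kappa> - \<kappa>) = 0" using assms(1,2) by (simp add: sig_simps scale_simps)
  then obtain i where i: "\<sigma> \<kappa> - \<kappa> = i *s \<xi>" using p_torsion by blast
  have "coprime j (int p)" using assms(4) p by (simp add: coprime_commute[of j] prime_imp_coprime)
  then obtain v where v: "[j * v = 1] (mod int p)" by (metis cong_solve_coprime_int)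
  have "[i * (j * v) = i * 1] (mod int p)" using v by (intro cong_mult) simp_all
  then have "int p dvd i * v * j - i" by (simp add: cong_iff_dvd_diff mult_ac)
  then have "(i * v * j - i) *s \<xi> = 0" by (simp only: scale_xi_eq_0_iff)
  then have "(i * v * j) *s \<xi> = i *s \<xi>" by (simp add: scale_simps)
  moreover have "\<sigma> \<kappa> = \<kappa> + i *s \<xi>" using i by (simp add: algebra_simps)
  ultimately have "\<sigma> (\<kappa> - (i * v) *s z) = \<kappa> - (i * v) *s z"
    by (simp add: sig_simps z(2) scale_simps)
  moreover have "int p *s (\<kappa> - (i * v) *s z) = y - (i * v) *s nrm (p ^ n) \<alpha>"
    by (simp add: assms(2) scale_simps mult.commute flip: z(1))
  ultimately show thesis using that by blast
qed

text \<open>The indices at which extracting a p^M-th root uses up every available factor p, so that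
  the root of the twisted norm may fail to be a multiple of p.\<close>

definition tight :: "nat \<Rightarrow> nat option list \<Rightarrow> nat \<Rightarrow> nat set" where
  "tight m a M = {t. t < m \<and> (\<exists>k. a ! t = Some k \<and> M + k = t + n)}"

text \<open>The formal roots V, together with multiples of \<alpha> and of its twisted norm, add up
  to a p^M-torsion element, which is a multiple of p by \<open>roots\<close>. Modulo p all other
  contributions vanish and each tight V becomes a plain norm, so the sum of these norms is a
  multiple of p as well.\<close>

lemma tight_norms_divisible:
  assumes a: "admissible_vec m a" and \<delta>: "has_levels m a \<delta>"
    and rep: "\<sigma> \<alpha> = d *s \<alpha> + wsum m \<delta>" and e: "kummer_char j \<alpha>" "\<not> int p dvd j"
    and c: "[c = 1] (mod int p)" "p = 2 \<Longrightarrow> [c = 1] (mod 4)"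
    and M: "M < m" "\<And>t k. t < m \<Longrightarrow> a ! t = Some k \<Longrightarrow> M + k \<le> t + n"
    and dc: "int p ^ M dvd d - c" and cn: "int p ^ Suc M dvd c ^ p ^ n - 1"
    and roots: "\<And>x. int p ^ M *s x = 0 \<Longrightarrow> \<exists>y. x = int p *s y"
  shows "\<exists>\<kappa>. (\<Sum>t\<in>tight m a M. nrm (p ^ (t + n - M)) (\<delta> t)) = int p *s \<kappa>"
proof -
  let ?I = "tight m a M" and ?T = "tnrm c (p ^ n) \<alpha>"
  obtain b0 where b0: "c ^ p ^ n - 1 = int p ^ M * (int p * b0)"
    using cn by (metis dvdE mult.assoc power_Suc2)
  obtain u where u: "d - c = int p ^ M * u" using dc by blast
  obtain g where g: "c = 1 + int p * g" using c(1) by (metis cong_iff_lin cong_sym)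
  obtain z where z: "int p *s z = nrm (p ^ n) \<alpha>" using e(1) by (auto simp: kummer_char_def)
  have T: "?T = int p *s (z + dnrm g (p ^ n) \<alpha>)"
    unfolding g tnrm_eq_dnrm by (simp add: scale_simps z)
  obtain V where V: "int p ^ M *s ((\<Sum>t\<le>m. V t) + (int p * b0) *s \<alpha>) = (c - d) *s ?T"
    "\<And>t. t < m \<Longrightarrow> \<forall>k. a ! t = Some k \<longrightarrow> M + k \<noteq> t + n \<Longrightarrow> \<exists>y. V t = int p *s y"
    "M < m \<Longrightarrow> \<exists>y. V m = int p *s y"
    "\<And>t k. t < m \<Longrightarrow> a ! t = Some k \<Longrightarrow> M + k = t + n
       \<Longrightarrow> \<exists>y. V t = nrm (p ^ k) (\<delta> t) + int p *s y"
    by (rule twisted_roots[OF a \<delta> c less_imp_le[OF M(1)] M(2) b0 rep]) blast+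
  have "\<exists>y. V t = (if t \<in> ?I then nrm (p ^ (t + n - M)) (\<delta> t) else 0) + int p *s y" if "t \<le> m" for t
  proof (cases "t \<in> ?I")
    case True
    then obtain k where k: "t < m" "a ! t = Some k" "M + k = t + n" by (auto simp: tight_def)
    then have "k = t + n - M" by simp
    then show ?thesis using V(4)[OF k] True by simp
  next
    case False
    then show ?thesis using V(2)[of t] V(3) M(1) that by (cases "t = m") (auto simp: tight_def)
  qed
  then obtain Y where Y: "\<And>t. t \<le> m \<Longrightarrow>
      V t = (if t \<in> ?I then nrm (p ^ (t + n - M)) (\<delta> t) else 0) + int p *s Y t" by metis
  have I: "?I \<subseteq> {..m}" by (auto simp: tight_def)
  have "(\<Sum>t\<le>m. V t) = (\<Sum>t\<le>m. if t \<in> ?I then nrm (p ^ (t + n - M)) (\<delta> t) else 0)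
      + int p *s (\<Sum>t\<le>m. Y t)"
    by (simp add: Y sum.distrib scale_sum_right)
  also have "(\<Sum>t\<le>m. if t \<in> ?I then nrm (p ^ (t + n - M)) (\<delta> t) else 0) =
      (\<Sum>t\<in>?I. nrm (p ^ (t + n - M)) (\<delta> t))"
    using I by (simp add: sum.If_cases Int_absorb1)
  finally have s: "(\<Sum>t\<in>?I. nrm (p ^ (t + n - M)) (\<delta> t)) = (\<Sum>t\<le>m. V t) - int p *s (\<Sum>t\<le>m. Y t)"
    by simp
  have "int p ^ M *s ((\<Sum>t\<le>m. V t) + (int p * b0) *s \<alpha> + u *s ?T) = (c - d) *s ?T + (d - c) *s ?T"
    unfolding scale_right_distrib[of _ _ "u *s _"] V(1) by (simp add: u)
  also have "\<dots> = 0" by (simp add: scale_simps)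
  finally obtain Q where "(\<Sum>t\<le>m. V t) + (int p * b0) *s \<alpha> + u *s ?T = int p *s Q"
    using roots by blast
  then have "(\<Sum>t\<le>m. V t) = int p *s Q - (int p * b0) *s \<alpha> - u *s ?T" by (simp add: algebra_simps)
  then have "(\<Sum>t\<in>?I. nrm (p ^ (t + n - M)) (\<delta> t)) =
      int p *s (Q - b0 *s \<alpha> - u *s (z + dnrm g (p ^ n) \<alpha>) - (\<Sum>t\<le>m. Y t))"
    unfolding s T by (simp add: scale_simps mult.commute)
  then show ?thesis by blast
qed

text \<open>The factors \<open>\<delta>\<^sub>t\<close> with \<open>t\<close> in the tight set are collected, together with a power of \<open>\<alpha>\<close> that is
  paid for by changing \<open>d\<close>, into an element \<open>E\<close> at the smallest tight index \<open>s\<close>. The norm of \<open>E\<close> is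
  \<open>f\<close> to the power \<open>p\<^bsup>n - k + 1\<^esup>\<close>, so \<open>f\<close> is a norm from \<open>K\<^bsub>k - 1\<^esub>\<close>, and by Hilbert 90 \<open>E\<close> can be
  replaced by an element of \<open>K\<^bsub>k - 1\<^esub>\<close>.\<close>

lemma lower_vector_exists:
  assumes a: "tame a" and np: "add_norm_pair m a d"
    and c: "[c = 1] (mod int p)" "p = 2 \<Longrightarrow> [c = 1] (mod 4)"
    and M: "M < m" "\<And>t k. t < m \<Longrightarrow> a ! t = Some k \<Longrightarrow> M + k \<le> t + n"
    and tight: "tight m a M \<noteq> {}"
    and dc: "int p ^ M dvd d - c" and cn: "int p ^ Suc M dvd c ^ p ^ n - 1"
    and roots: "\<And>x. int p ^ M *s x = 0 \<Longrightarrow> \<exists>y. x = int p *s y"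
  shows "\<exists>a' d'. add_norm_pair m a' d' \<and> lex_less a' a"
proof -
  obtain \<alpha> \<delta> j where *: "admissible_vec m a" "[d = 1] (mod int p)" "has_levels m a \<delta>"
      "\<sigma> \<alpha> = d *s \<alpha> + wsum m \<delta>" "kummer_char j \<alpha>" "\<not> int p dvd j"
    using a np add_norm_pair_iff by blast
  define I where "I = tight m a M"
  define y where "y = (\<Sum>t\<in>I. nrm (p ^ (t + n - M)) (\<delta> t))"
  have finI: "finite I" by (simp add: I_def tight_def)
  have I: "t < m" "a ! t = Some (t + n - M)" "M \<le> t + n" "t \<le> M" "\<delta> t \<in> fixd (p ^ (t + n - M))"
    if t: "t \<in> I" for t
  proof -
    obtain k where k: "t < m" "a ! t = Some k" "M + k = t + n"
      using t by (auto simp: I_def tight_def)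
    moreover have "k \<le> n" using *(1) k by (auto simp: admissible_vec_def)
    moreover have "\<delta> t \<in> fixd (p ^ k)" using *(3) k by (auto simp: has_levels_def)
    moreover have "k = t + n - M" using k by simp
    ultimately show "t < m" "a ! t = Some (t + n - M)" "M \<le> t + n" "t \<le> M"
      "\<delta> t \<in> fixd (p ^ (t + n - M))" by simp_all
  qed
  have "\<sigma> y = y" unfolding y_def sig_simps
    using nrm_in_F[OF I(5)] by (intro sum.cong) (auto simp: fixd_1_iff)
  moreover obtain \<kappa> where "y = int p *s \<kappa>"
    using tight_norms_divisible[OF *(1,3,4,5,6) c M dc cn roots] unfolding y_def I_def by blast
  ultimately obtain l f where f: "\<sigma> f = f" "int p *s f = y - l *s nrm (p ^ n) \<alpha>"
    using p_divisible_fixed *(5,6) by blast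
  define s where "s = Min I"
  have s: "s \<in> I" "\<And>t. t \<in> I \<Longrightarrow> s \<le> t"
    using finI tight by (auto simp: s_def I_def)
  define k where "k = s + n - M"
  have k: "k \<le> n" "M = s + (n - k)" using I(3,4)[OF s(1)] by (auto simp: k_def)
  define r where "r = n - k"
  have Mr: "M = s + r" using k by (simp add: r_def)
  \<comment> \<open>This keeps the new exponent congruent to 1 modulo p. It rests on the condition
    that the first entry is less than n.\<close>
  have M1: "M \<ge> 1"
  proof (cases "s = 0")
    case True
    then have "k < n" using I(2)[OF s(1)] *(1) by (auto simp: admissible_vec_def k_def)
    then show ?thesis using k by simp
  next
    case False then show ?thesis using Mr by simp
  qed
  have nI: "nrm (p ^ n) (\<delta> t) = int p ^ (M - t) *s nrm (p ^ (t + n - M)) (\<delta> t)" if "t \<in> I" for t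
    using nrm_level[OF I(5)[OF that], of n] I(3,4)[OF that] by simp
  define EI where "EI = (\<Sum>t\<in>I. int p ^ (t - s) *s \<delta> t)"
  define E where "E = EI - (int p ^ r * l) *s \<alpha>"
  have "nrm (p ^ n) EI = (\<Sum>t\<in>I. int p ^ r *s nrm (p ^ (t + n - M)) (\<delta> t))"
    unfolding EI_def nrm_simps
  proof (intro sum.cong refl)
    fix t assume t: "t \<in> I"
    have "int p ^ (t - s) * int p ^ (M - t) = int p ^ r"
      using s(2)[OF t] I(4)[OF t] Mr by (simp flip: power_add)
    then show "int p ^ (t - s) *s nrm (p ^ n) (\<delta> t) = int p ^ r *s nrm (p ^ (t + n - M)) (\<delta> t)"
      by (simp add: nI[OF t])
  qed
  then have "nrm (p ^ n) EI = int p ^ r *s y" by (simp add: y_def scale_sum_right)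
  then have "nrm (p ^ n) E = int p ^ r *s (y - l *s nrm (p ^ n) \<alpha>)"
    by (simp add: E_def nrm_simps scale_simps)
  then have nE: "nrm (p ^ n) E = int p ^ Suc r *s f"
    by (simp add: f(2)[symmetric] mult.commute)
  \<comment> \<open>For k > 0 the replacement \<open>lm\<close> has level k - 1 and
    \<open>f0\<close> is 0. For k = 0 no smaller field exists: the entry drops to
    \<open>None\<close>, and f itself becomes \<open>f0\<close>, whose factor p carries it into the
    next index. The last property records the norm one factor p earlier, as the case s = 0
    requires.\<close>
  obtain lm f0 b where lam: "nrm (p ^ n) (lm + int p *s f0) = int p ^ Suc r *s f"
      "olt b (Some k)" "case b of None \<Rightarrow> lm = 0 | Some k' \<Rightarrow> lm \<in> fixd (p ^ k') \<and> k' < k"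
      "s = 0 \<Longrightarrow> lm \<in> fixd (p ^ (n - 1)) \<and> nrm (p ^ (n - 1)) lm + nrm (p ^ n) f0 = int p ^ r *s f"
  proof (cases k)
    case 0
    have "nrm (p ^ n) f = int p ^ n *s f"
      using nrm_level[of f 0 n] f(1) by (simp add: fixd_1_iff)
    then show ?thesis using 0
      by (intro that[of 0 f None]) (auto simp: r_def nrm_simps)
  next
    case (Suc k')
    have r: "Suc r \<le> n" "n - Suc r = k'" "n - k' = Suc r" using Suc k by (auto simp: r_def)
    obtain lm where la: "lm \<in> fixd (p ^ k')" "nrm (p ^ k') lm = f"
      using norm_descent[OF f(1) nE[symmetric] r(1)] r(2) by auto
    have "nrm (p ^ n) lm = int p ^ Suc r *s f" using nrm_level[OF la(1), of n] la(2) r by simp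
    moreover have "k' \<le> n - 1" "n - 1 - k' = r" using r by auto
    then have "lm \<in> fixd (p ^ (n - 1))" "nrm (p ^ (n - 1)) lm = int p ^ r *s f"
      using fixd_mono[OF la(1)] nrm_level[OF la(1), of "n - 1"] la(2) by simp_all
    ultimately show ?thesis using la Suc
      by (intro that[of lm 0 "Some k'"]) (auto simp: nrm_simps)
  qed
  have "(\<Sum>i<p ^ (n - 0). (\<sigma> ^^ (p ^ 0 * i)) (E - (lm + int p *s f0))) = nrm (p ^ n) (E - (lm + int p *s f0))"
    by (simp add: nrm_def)
  also have "\<dots> = 0" using nE lam(1) by (simp add: nrm_simps)
  finally obtain \<mu> where "E - (lm + int p *s f0) = (\<sigma> ^^ (p ^ 0)) \<mu> - \<mu>"
    using hilbert90[of 0] by blast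
  then have mu: "\<sigma> \<mu> = \<mu> + (E - (lm + int p *s f0))" by simp
  have kummer_char_mu: "kummer_char 0 (int p ^ s *s \<mu>)"
  proof (cases s)
    case (Suc s')
    then show ?thesis by (intro kummer_char_zeroI[of _ "int p ^ s' *s nrm (p ^ n) \<mu>"])
      (simp_all add: nrm_simps sig_simps)
  next
    case 0
    then have rM: "r = M" using Mr by simp
    have kn: "k \<le> n - 1" "n - 1 - k = M - 1" using M1 rM by (auto simp: r_def)
    \<comment> \<open>Equal norms of E and of its replacement determine the character of \<mu> only
      up to a multiple of \<xi>. So E is split as \<open>\<delta> 0\<close> plus p times X, and the
      norms are compared after formal division by p.\<close>
    define X where "X = (\<Sum>t\<in>I - {0}. int p ^ (t - 1) *s \<delta> t) - (int p ^ (M - 1) * l) *s \<alpha>"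
    have d0: "\<delta> 0 \<in> fixd (p ^ k)" using I(5)[of 0] s(1) 0 by (simp add: k_def)
    have d0n: "\<delta> 0 \<in> fixd (p ^ (n - 1))" using fixd_mono[OF d0 kn(1)] .
    have "EI = \<delta> 0 + (\<Sum>t\<in>I - {0}. int p ^ t *s \<delta> t)"
      using s(1) finI 0 by (simp add: EI_def sum.remove)
    also have "(\<Sum>t\<in>I - {0}. int p ^ t *s \<delta> t) = int p *s (\<Sum>t\<in>I - {0}. int p ^ (t - 1) *s \<delta> t)"
      unfolding scale_sum_right scale_scale power_Suc[symmetric] by (intro sum.cong) auto
    finally have EX: "E = \<delta> 0 + int p *s X"
      using M1 by (simp add: E_def X_def rM scale_simps mult.assoc[symmetric] flip: power_Suc)
    have "y = nrm (p ^ k) (\<delta> 0) + (\<Sum>t\<in>I - {0}. nrm (p ^ (t + n - M)) (\<delta> t))"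
      using s(1) finI 0 by (simp add: y_def sum.remove k_def)
    moreover have "nrm (p ^ n) (\<Sum>t\<in>I - {0}. int p ^ (t - 1) *s \<delta> t) =
        (\<Sum>t\<in>I - {0}. int p ^ (M - 1) *s nrm (p ^ (t + n - M)) (\<delta> t))"
      unfolding nrm_simps
    proof (intro sum.cong refl)
      fix t assume t: "t \<in> I - {0}"
      then have "int p ^ (t - 1) * int p ^ (M - t) = int p ^ (M - 1)"
        using I(4)[of t] by (simp flip: power_add)
      then show "int p ^ (t - 1) *s nrm (p ^ n) (\<delta> t) = int p ^ (M - 1) *s nrm (p ^ (t + n - M)) (\<delta> t)"
        using nI[of t] t by simp
    qed
    ultimately have "nrm (p ^ (n - 1)) (\<delta> 0) + nrm (p ^ n) X =
        int p ^ (M - 1) *s (y - l *s nrm (p ^ n) \<alpha>)"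
      using nrm_level[OF d0 kn(1)] kn(2)
      by (simp add: X_def nrm_simps scale_simps scale_sum_right)
    then have nX: "nrm (p ^ (n - 1)) (\<delta> 0) + nrm (p ^ n) X = int p ^ r *s f"
      using M1 by (simp add: f(2)[symmetric] rM flip: power_Suc2)
    have "\<sigma> \<mu> = \<mu> + (\<delta> 0 - lm) + int p *s (X - f0)"
      unfolding mu EX by (simp add: scale_simps)
    moreover have "\<delta> 0 - lm \<in> fixd (p ^ (n - 1))" using d0n lam(4)[OF 0] by blast
    moreover have "odd p \<or> n \<ge> 2 \<or> \<delta> 0 - lm = 0"
      using a I(2)[OF s(1)] 0 by (auto simp: tame_def)
    ultimately obtain z where z: "int p *s z = nrm (p ^ n) \<mu>"
        "\<sigma> z = z + nrm (p ^ (n - 1)) (\<delta> 0 - lm) + nrm (p ^ n) (X - f0)"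
      using kummer_char_of_decomp[of \<mu> "\<delta> 0 - lm" "X - f0"] by blast
    have "nrm (p ^ (n - 1)) (\<delta> 0 - lm) + nrm (p ^ n) (X - f0) = 0"
      using nX lam(4)[OF 0] by (simp add: nrm_simps algebra_simps)
    then have "\<sigma> z = z" using z(2) by (simp add: add.assoc)
    then show ?thesis using kummer_char_zeroI[OF z(1)[symmetric]] 0 by simp
  qed
  define \<alpha>' where "\<alpha>' = 1 *s \<alpha> + (- 1) *s (int p ^ s *s \<mu>)"
  \<comment> \<open>The multiple p^r l \<alpha> that was subtracted to form E has weight p^s in the
    equation for \<alpha>, and M = s + r.\<close>
  define d' where "d' = d + int p ^ M * l"
  have d': "[d' = 1] (mod int p)"
    using *(2) M1 cong_add[OF *(2), of "int p ^ M * l" 0] by (simp add: d'_def cong_0_iff dvd_power)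
  then obtain g where g: "d' = 1 + int p * g" by (metis cong_iff_lin cong_sym)
  define \<delta>I where "\<delta>I = (\<lambda>t. if t \<in> I then \<delta> t else 0)"
  define \<delta>N where "\<delta>N = (\<lambda>t. if t \<in> I then 0 else \<delta> t)"
  define G where "G = (\<Sum>i\<in>{Suc s..m}. int p ^ (i - Suc s) *s \<delta>N i)"
  \<comment> \<open>Writing d' = 1 + p g, the difference between p^s \<mu> and d' p^s \<mu> is p^(s
    + 1) g \<mu>, whence the summand with g. G gathers the non-tight factors of index above
    s.\<close>
  define \<delta>' where "\<delta>' = (\<lambda>t. if t < s then \<delta> t else if t = s then lm
      else if t = Suc s then G + f0 + g *s \<mu> else 0)"
  \<comment> \<open>The drop at s decides the lexicographic order, so the later entries are set to n
    and impose no condition on their factors.\<close>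
  define a' where "a' = map (\<lambda>i. if i < s then a ! i else if i = s then b else Some n) [0..<m]"
  have sm: "s < m" using I(1)[OF s(1)] .
  have I_le: "I \<subseteq> {..m}" using I(1) less_imp_le by blast
  have w: "wsum m \<delta> = wsum m \<delta>I + wsum m \<delta>N"
    unfolding wsum_add[symmetric] by (simp add: wsum_def \<delta>I_def \<delta>N_def cong: if_cong)
      (intro sum.cong, auto)
  have "wsum m \<delta>I = (\<Sum>t\<le>m. if t \<in> I then int p ^ t *s \<delta> t else 0)"
    unfolding wsum_def \<delta>I_def by (intro sum.cong) auto
  also have "\<dots> = (\<Sum>t\<in>I. int p ^ t *s \<delta> t)"
    using I_le by (simp add: sum.If_cases Int_absorb1)
  also have "\<dots> = int p ^ s *s EI"
    unfolding EI_def scale_sum_right scale_scale power_add[symmetric]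
    using s(2) by (intro sum.cong) auto
  finally have wI: "wsum m \<delta>I = int p ^ s *s EI" .
  have "(\<Sum>i<s. int p ^ i *s \<delta>N i) = (\<Sum>i<s. int p ^ i *s \<delta> i)"
    using s(2) by (intro sum.cong) (auto simp: \<delta>N_def dest!: s(2))
  then have wN: "wsum m \<delta>N = (\<Sum>i<s. int p ^ i *s \<delta> i) + int p ^ Suc s *s G"
    unfolding wsum_split_at[OF sm] G_def using s(1) by (simp add: \<delta>N_def)
  have "(\<Sum>i\<in>{Suc s..m}. int p ^ (i - Suc s) *s \<delta>' i) =
      (\<Sum>i\<in>{Suc s..m}. if i = Suc s then G + f0 + g *s \<mu> else 0)"
    by (intro sum.cong) (auto simp: \<delta>'_def)
  also have "\<dots> = G + f0 + g *s \<mu>" using sm by simp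
  finally have w': "wsum m \<delta>' = (\<Sum>i<s. int p ^ i *s \<delta> i) + int p ^ s *s lm
      + int p ^ Suc s *s (G + f0 + g *s \<mu>)"
    unfolding wsum_split_at[OF sm] by (simp add: \<delta>'_def)
  have pM: "int p ^ M * l = int p ^ s * (int p ^ r * l)" by (simp add: Mr power_add mult.assoc)
  have "\<sigma> \<alpha>' = d *s \<alpha> + wsum m \<delta> - int p ^ s *s (\<mu> + (E - (lm + int p *s f0)))"
    by (simp add: \<alpha>'_def sig_simps *(4) mu)
  also have "\<dots> = (d + int p ^ M * l) *s \<alpha> + wsum m \<delta>N
      - int p ^ s *s \<mu> + int p ^ s *s lm + int p ^ Suc s *s f0"
    unfolding w wI E_def pM by (simp add: scale_simps mult_ac)
  also have "\<dots> = d' *s \<alpha>' + wsum m \<delta>'"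
    unfolding w' wN d'_def[symmetric] \<alpha>'_def g by (simp add: scale_simps distrib_left mult_ac)
  finally have rep': "\<sigma> \<alpha>' = d' *s \<alpha>' + wsum m \<delta>'" .
  have bk: "k' < k" if "b = Some k'" for k' using lam(2) that by simp
  have has_levels': "has_levels m a' \<delta>'"
    using *(3) lam(3) by (auto simp: has_levels_def a'_def \<delta>'_def split: option.splits)
  have m1: "m \<ge> 1" using *(1) by (simp add: admissible_vec_def)
  have adv: "admissible_vec m a'"
    using *(1) bk k(1) m1 unfolding admissible_vec_def a'_def
    by (auto split: if_splits intro: order.trans[OF less_imp_le] less_le_trans)
  have tame': "tame a'"
    using a I(2)[OF s(1)] m1 by (cases "s = 0") (auto simp: tame_def a'_def)
  have "kummer_char (1 * j + (- 1) * 0) \<alpha>'" unfolding \<alpha>'_def by (intro kummer_char_combine *(5) kummer_char_mu)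
  then have "add_norm_pair m a' d'" using add_norm_pair_I[OF tame' adv d' has_levels' rep'] *(6) by simp
  moreover have "lex_less a' a"
    unfolding lex_less_def using sm *(1) lam(2) I(2)[OF s(1)]
    by (intro exI[of _ s]) (auto simp: a'_def admissible_vec_def k_def)
  ultimately show ?thesis by blast
qed

lemma add_norm_pair_cyclotomic_cong:
  assumes a: "tame a" and np: "add_norm_pair m a d"
    and least: "\<And>a' d'. add_norm_pair m a' d' \<Longrightarrow> \<not> lex_less a' a"
    and c: "[c = 1] (mod int p)" "p = 2 \<Longrightarrow> [c = 1] (mod 4)"
    and e: "e \<le> m" "int p ^ e dvd c ^ p ^ n - 1"
    and roots: "\<And>x. int p ^ e *s x = 0 \<Longrightarrow> \<sigma> x = c *s x"
      "\<And>M x. M < e \<Longrightarrow> int p ^ M *s x = 0 \<Longrightarrow> \<exists>y. x = int p *s y"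
  shows "int p ^ e dvd d - c"
proof (rule ccontr)
  assume "\<not> ?thesis"
  then obtain i u where i: "i < e" "d - c = int p ^ i * u" "\<not> int p dvd u"
    using not_prime_power_dvd_cases by blast
  obtain \<alpha> \<delta> j where *: "admissible_vec m a" "has_levels m a \<delta>"
      "\<sigma> \<alpha> = d *s \<alpha> + wsum m \<delta>" "kummer_char j \<alpha>" "\<not> int p dvd j"
    using a np add_norm_pair_iff by blast
  have cn: "int p ^ Suc M dvd c ^ p ^ n - 1" if "M \<le> i" for M
    using e(2) that i(1) by (meson dvd_trans le_imp_power_dvd le_less_trans Suc_leI)
  obtain t k where t: "t < m" "a ! t = Some k" "t + n \<le> i + k"
    using close_level_exists[OF * c _ i(2,3) cn[OF order_refl]] i(1) e(1)
      roots(1)[OF torsion_mono[OF Suc_leI[OF i(1)]]] by (meson less_le_trans)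
  define P where "P = (\<lambda>M. \<exists>t<m. \<exists>k. a ! t = Some k \<and> M + k = t + n)"
  \<comment> \<open>The least value of t + n - k over the entries \<open>Some k\<close>. Minimality
    gives the inequality for all levels, attainment gives a tight index, and
    \<open>close_level_exists\<close> gives that M is at most i.\<close>
  define M where "M = (LEAST M. P M)"
  have ex: "P (t + n - k)" if "t < m" "a ! t = Some k" for t k
  proof -
    have "k \<le> n" using *(1) that by (auto simp: admissible_vec_def)
    then show ?thesis using that unfolding P_def by fastforce
  qed
  have PM: "P M" unfolding M_def by (rule LeastI) (rule ex[OF t(1,2)])
  have Mle: "M + k \<le> t + n" if "t < m" "a ! t = Some k" for t k
  proof -
    have "k \<le> n" using *(1) that by (auto simp: admissible_vec_def)
    moreover have "M \<le> t + n - k" unfolding M_def by (rule Least_le) (rule ex[OF that])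
    ultimately show ?thesis by simp
  qed
  have Mi: "M \<le> i" using Mle[OF t(1,2)] t(3) by simp
  have "int p ^ M dvd d - c" unfolding i(2) using Mi by (simp add: le_imp_power_dvd)
  moreover have "tight m a M \<noteq> {}" using PM by (auto simp: tight_def P_def)
  ultimately have "\<exists>a' d'. add_norm_pair m a' d' \<and> lex_less a' a"
    using lower_vector_exists[OF a np c _ Mle _ _ cn[OF Mi]] roots(2) Mi i(1) e(1)
    by (meson le_less_trans less_le_trans)
  then show False using least by blast
qed

end

section \<open>The multiplicative group of a field as an additive group\<close>

typedef (overloaded) ('a::field) nonzero = "{x::'a. x \<noteq> 0}"
  by (intro exI[of _ 1]) simp

lemma Rep_nonzero_neq_0 [simp]: "Rep_nonzero x \<noteq> 0"
  using Rep_nonzero[of x] by simp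

lemma Abs_nonzero_inverse' [simp]: "x \<noteq> 0 \<Longrightarrow> Rep_nonzero (Abs_nonzero x) = x"
  by (simp add: Abs_nonzero_inverse)

instantiation nonzero :: (field) ab_group_add
begin

definition zero_nonzero :: "'a nonzero" where "0 = Abs_nonzero 1"
definition plus_nonzero :: "'a nonzero \<Rightarrow> 'a nonzero \<Rightarrow> 'a nonzero" where
  "x + y = Abs_nonzero (Rep_nonzero x * Rep_nonzero y)"
definition uminus_nonzero :: "'a nonzero \<Rightarrow> 'a nonzero" where
  "- x = Abs_nonzero (inverse (Rep_nonzero x))"
definition minus_nonzero :: "'a nonzero \<Rightarrow> 'a nonzero \<Rightarrow> 'a nonzero" where
  "x - y = Abs_nonzero (Rep_nonzero x / Rep_nonzero y)"

instance
  by standard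
    (simp_all add: zero_nonzero_def plus_nonzero_def uminus_nonzero_def minus_nonzero_def
      mult_ac divide_inverse Rep_nonzero_inverse flip: Rep_nonzero_inject)

end

definition nzpow :: "int \<Rightarrow> 'a::field nonzero \<Rightarrow> 'a nonzero" where
  "nzpow k x = Abs_nonzero (Rep_nonzero x powi k)"

definition nzmap :: "('a::field \<Rightarrow> 'a) \<Rightarrow> 'a nonzero \<Rightarrow> 'a nonzero" where
  "nzmap f x = Abs_nonzero (f (Rep_nonzero x))"

lemma Rep_nonzero_simps [simp]:
  "Rep_nonzero 0 = 1"
  "Rep_nonzero (x + y) = Rep_nonzero x * Rep_nonzero y"
  "Rep_nonzero (- x) = inverse (Rep_nonzero x)"
  "Rep_nonzero (x - y) = Rep_nonzero x / Rep_nonzero y"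
  "Rep_nonzero (nzpow k x) = Rep_nonzero x powi k"
  by (simp_all add: zero_nonzero_def plus_nonzero_def uminus_nonzero_def minus_nonzero_def nzpow_def)

lemma Rep_nonzero_sum [simp]: "Rep_nonzero (sum f A) = (\<Prod>i\<in>A. Rep_nonzero (f i))"
  by (induction A rule: infinite_finite_induct) simp_all

lemma nonzero_eq_iff: "x = y \<longleftrightarrow> Rep_nonzero x = Rep_nonzero y"
  by (simp add: Rep_nonzero_inject)

lemma module_nzpow: "Modules.module nzpow"
  by standard (simp_all add: nonzero_eq_iff power_int_mult_distrib power_int_add
      power_int_mult[symmetric] mult.commute)

section \<open>Roots of unity, root levels and the order on vectors\<close>

lemma prim_root_power_eq_1_iff:
  fixes \<zeta> :: "'a::field"
  assumes z: "prim_root \<zeta> N" and N: "N > 0"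
  shows "\<zeta> powi k = 1 \<longleftrightarrow> int N dvd k"
proof -
  have z0: "\<zeta> \<noteq> 0" using z N by (auto simp: prim_root_def power_0_left)
  define r where "r = nat (k mod int N)"
  have r: "int r = k mod int N" "r < N" using N by (simp_all add: r_def nat_less_iff)
  have "\<zeta> powi k = \<zeta> powi (int N * (k div int N) + int r)" using r(1) by simp
  also have "\<dots> = \<zeta> ^ r" using z z0
    by (subst power_int_add) (simp_all add: power_int_mult prim_root_def)
  finally have "\<zeta> powi k = 1 \<longleftrightarrow> \<zeta> ^ r = 1" by simp
  also have "\<dots> \<longleftrightarrow> r = 0" using z r(2) by (auto simp: prim_root_def)
  also have "\<dots> \<longleftrightarrow> int N dvd k" using r(1) by (simp add: dvd_eq_mod_eq_0 flip: r(1))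
  finally show ?thesis .
qed

text \<open>The N powers of \<zeta> are distinct roots of X^N - 1, which has at most N
  roots.\<close>

lemma prim_root_generates:
  fixes \<zeta> x :: "'a::field"
  assumes z: "prim_root \<zeta> N" and N: "N > 0" and x: "x ^ N = 1"
  obtains j where "x = \<zeta> ^ j"
proof -
  let ?p = "monom 1 N - 1 :: 'a poly"
  let ?R = "{x. poly ?p x = 0}"
  have "coeff ?p N = 1" using N by simp
  then have p0: "?p \<noteq> 0" by (metis coeff_0 zero_neq_one)
  have "degree ?p \<le> N" using N by (intro degree_diff_le) (simp_all add: degree_monom_le)
  then have card: "card ?R \<le> N" using card_poly_roots_bound[OF p0] by linarith
  have fin: "finite ?R" using poly_roots_finite[OF p0] .
  have z0: "\<zeta> \<noteq> 0" using z N by (auto simp: prim_root_def power_0_left)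
  have "inj_on (\<lambda>j. \<zeta> ^ j) {..<N}"
  proof (rule linorder_inj_onI')
    fix i j assume ij: "i \<in> {..<N}" "j \<in> {..<N}" "i < j"
    then have "\<zeta> ^ j = \<zeta> ^ i * \<zeta> ^ (j - i)" by (simp flip: power_add)
    moreover have "\<zeta> ^ (j - i) \<noteq> 1" using z ij by (auto simp: prim_root_def)
    ultimately show "\<zeta> ^ i \<noteq> \<zeta> ^ j" using z0 by auto
  qed
  then have "card ((\<lambda>j. \<zeta> ^ j) ` {..<N}) = N" by (simp add: card_image)
  moreover have "(\<lambda>j. \<zeta> ^ j) ` {..<N} \<subseteq> ?R"
    using z by (auto simp: prim_root_def poly_monom) (metis mult.commute power_mult power_one)
  ultimately have "(\<lambda>j. \<zeta> ^ j) ` {..<N} = ?R" using card fin by (intro card_seteq) auto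
  moreover have "x \<in> ?R" using x by (simp add: poly_monom)
  ultimately show thesis using that by blast
qed

lemma prim_root_power:
  assumes "prim_root \<zeta> (p ^ e)" "M \<le> e" "p > 0"
  shows "prim_root (\<zeta> ^ (p ^ (e - M))) (p ^ M)"
  unfolding prim_root_def
proof (intro conjI allI impI)
  have pe: "p ^ (e - M) * p ^ M = p ^ e" using assms by (simp flip: power_add)
  show "(\<zeta> ^ p ^ (e - M)) ^ p ^ M = 1"
    using assms(1) pe by (simp add: prim_root_def flip: power_mult)
  fix j assume j: "0 < j \<and> j < p ^ M"
  then have "p ^ (e - M) * j < p ^ e" "0 < p ^ (e - M) * j" unfolding pe[symmetric] using assms(3) by simp_all
  then show "(\<zeta> ^ p ^ (e - M)) ^ j \<noteq> 1"
    using assms(1) by (simp add: prim_root_def flip: power_mult)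
qed

lemma power_gcd_eq_1:
  fixes x :: "'a::field"
  assumes "x ^ a = 1" "x ^ b = 1"
  shows "x ^ gcd a b = 1"
proof (cases "a = 0")
  case False
  then obtain u v where "a * u = b * v + gcd a b" using bezout_nat by blast
  then have "x ^ (a * u) = x ^ (b * v) * x ^ gcd a b" by (simp flip: power_add)
  then show ?thesis using assms by (simp add: power_mult)
qed (use assms in simp)

lemma prim_root_exists_order:
  fixes x :: "'a::field"
  assumes p: "prime p" and x: "x ^ (p ^ m) = 1"
  obtains k where "k \<le> m" "prim_root x (p ^ k)"
proof -
  define k where "k = (LEAST k. x ^ (p ^ k) = 1)"
  have k: "x ^ (p ^ k) = 1" unfolding k_def by (rule LeastI[where P = "\<lambda>k. x ^ (p ^ k) = 1", OF x])
  have least: "k \<le> i" if "x ^ (p ^ i) = 1" for i unfolding k_def by (rule Least_le) (rule that)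
  have "x ^ j \<noteq> 1" if j: "0 < j" "j < p ^ k" for j
  proof
    assume "x ^ j = 1"
    then have g: "x ^ gcd j (p ^ k) = 1" using k by (rule power_gcd_eq_1)
    obtain i where i: "i \<le> k" "gcd j (p ^ k) = p ^ i"
      using divides_primepow_nat[OF p, of "gcd j (p ^ k)" k] by auto
    then have "i = k" using least[of i] g by simp
    then show False using i j by (metis dvd_imp_le gcd_dvd1 leD)
  qed
  then show thesis using that[OF least[OF x]] k by (simp add: prim_root_def)
qed

text \<open>The levels that occur form an initial segment, so the definite description in
  \<open>root_level\<close> denotes its last element. The infinite and the finite case thereby get
  one common form.\<close>

lemma le_root_level_iff:
  assumes "\<And>k. has_roots S p (Suc k) \<Longrightarrow> has_roots S p k" "has_roots S p 0"
  shows "enat k \<le> root_level S p \<longleftrightarrow> has_roots S p k"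
proof (cases "\<forall>k. has_roots S p k")
  case True then show ?thesis by (simp add: root_level_def)
next
  case False
  have mono: "has_roots S p i" if "has_roots S p j" "i \<le> j" for i j
    using that(2,1) by (induction rule: inc_induct) (auto intro: assms(1))
  define l where "l = (LEAST k. \<not> has_roots S p k)"
  have l: "\<not> has_roots S p l" unfolding l_def using False LeastI_ex[of "\<lambda>k. \<not> has_roots S p k"] by auto
  have lt: "has_roots S p i \<longleftrightarrow> i < l" for i
    using not_less_Least[of i "\<lambda>k. \<not> has_roots S p k"] mono[of i l] l
    unfolding l_def by (metis leI)
  obtain l' where l': "l = Suc l'" using lt[of 0] assms(2) gr0_implies_Suc by blast
  have "(THE k. has_roots S p k \<and> \<not> has_roots S p (Suc k)) = l'"
    by (rule the_equality) (auto simp: lt l')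
  then show ?thesis using False by (auto simp: root_level_def lt l')
qed

lemma le_tval_iff:
  assumes "prime p"
  shows "j \<le> tval p m x \<longleftrightarrow> j \<le> m \<and> int p ^ j dvd x"
proof -
  have "x \<noteq> 0 \<Longrightarrow> int p ^ j dvd x \<longleftrightarrow> j \<le> multiplicity (int p) x"
    using assms by (intro power_dvd_iff_le_multiplicity) auto
  then show ?thesis by (auto simp: tval_def)
qed

lemma olt_asym: "olt x y \<Longrightarrow> \<not> olt y x"
  by (cases x; cases y) auto

lemma lex_less_asym:
  assumes "lex_less a b" shows "\<not> lex_less b a"
proof
  assume "lex_less b a"
  then obtain j where j: "\<forall>i<j. b ! i = a ! i" "olt (b ! j) (a ! j)" by (auto simp: lex_less_def)
  obtain i where i: "\<forall>j<i. a ! j = b ! j" "olt (a ! i) (b ! i)" using assms by (auto simp: lex_less_def)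
  show False using i j olt_asym[of "a ! i" "b ! i"] by (cases i j rule: linorder_cases) (auto dest: olt_asym)
qed

section \<open>Dedekind independence, Hilbert 90 and the passage to additive form\<close>

lemma characters_independent:
  fixes \<tau> :: "nat \<Rightarrow> 'a::field \<Rightarrow> 'a"
  assumes mult: "\<And>j x y. \<tau> j (x * y) = \<tau> j x * \<tau> j y" and one: "\<And>j. \<tau> j 1 = 1"
    and dist: "\<And>i j. i < j \<Longrightarrow> j < L \<Longrightarrow> \<tau> i \<noteq> \<tau> j"
    and zero: "\<And>x. (\<Sum>j<L. c j * \<tau> j x) = 0" and j: "j < L"
  shows "c j = 0"
  using dist zero j
proof (induction L arbitrary: c j)
  case (Suc L)
  have low: "c i = 0" if i: "i < L" for i
  proof -
    obtain y where y: "\<tau> i y \<noteq> \<tau> L y" using Suc.prems(1)[of i L] i by blast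
    have "(\<Sum>j<L. (c j * (\<tau> j y - \<tau> L y)) * \<tau> j x) = 0" for x
    proof -
      have "(\<Sum>j<Suc L. c j * \<tau> j (y * x)) - \<tau> L y * (\<Sum>j<Suc L. c j * \<tau> j x) = 0"
        using Suc.prems(2) by simp
      then show ?thesis by (simp add: mult sum_distrib_left algebra_simps sum_subtractf)
    qed
    then have "c i * (\<tau> i y - \<tau> L y) = 0"
      using Suc.IH[of "\<lambda>j. c j * (\<tau> j y - \<tau> L y)" i] Suc.prems(1) i by simp
    then show ?thesis using y by simp
  qed
  then have "(\<Sum>j<L. c j * \<tau> j 1) = 0" by simp
  then have "c L = 0" using Suc.prems(2)[of 1] by (simp add: one)
  then show ?case using low Suc.prems(3) by (cases "j = L") auto
qed simp

locale cyclic_extension =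
  fixes \<sigma> :: "'a::field \<Rightarrow> 'a" and p n :: nat and \<xi> :: 'a
  assumes prime_p: "prime p" and n_pos: "n \<ge> 1" and aut: "field_aut \<sigma>"
    and ord1: "\<sigma> ^^ (p ^ n) = id" and ord2: "\<sigma> ^^ (p ^ (n - 1)) \<noteq> id"
    and xi: "prim_root \<xi> p" and xi_fixed: "\<sigma> \<xi> = \<xi>"
begin

lemma aut_plus: "(\<sigma> ^^ j) (x + y) = (\<sigma> ^^ j) x + (\<sigma> ^^ j) y"
  using aut by (induction j) (simp_all add: field_aut_def)

lemma aut_mult: "(\<sigma> ^^ j) (x * y) = (\<sigma> ^^ j) x * (\<sigma> ^^ j) y"
  using aut by (induction j) (simp_all add: field_aut_def)

lemma inj_aut: "inj (\<sigma> ^^ j)"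
  using aut by (induction j) (auto simp: field_aut_def bij_def intro: inj_compose)

lemma aut_0 [simp]: "(\<sigma> ^^ j) 0 = 0"
  using aut_plus[of j 0 0] by (metis add_cancel_left_right)

lemma aut_eq_0_iff [simp]: "(\<sigma> ^^ j) x = 0 \<longleftrightarrow> x = 0"
  using inj_aut[of j] by (metis aut_0 inj_eq)

lemma aut_1 [simp]: "(\<sigma> ^^ j) 1 = 1"
  using aut_mult[of j 1 1] by simp

lemma aut_sum: "(\<sigma> ^^ j) (\<Sum>i\<in>A. f i) = (\<Sum>i\<in>A. (\<sigma> ^^ j) (f i))"
  by (induction A rule: infinite_finite_induct) (simp_all add: aut_plus)

lemma aut_prod: "(\<sigma> ^^ j) (\<Prod>i\<in>A. f i) = (\<Prod>i\<in>A. (\<sigma> ^^ j) (f i))"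
  by (induction A rule: infinite_finite_induct) (simp_all add: aut_mult)

lemma aut_power: "(\<sigma> ^^ j) (x ^ k) = (\<sigma> ^^ j) x ^ k"
  by (induction k) (simp_all add: aut_mult)

lemma aut_inverse: "(\<sigma> ^^ j) (inverse x) = inverse ((\<sigma> ^^ j) x)"
proof (cases "x = 0")
  case False
  then have "(\<sigma> ^^ j) (inverse x) * (\<sigma> ^^ j) x = 1" by (simp flip: aut_mult)
  then show ?thesis by (metis inverse_unique inverse_inverse_eq)
qed simp

lemma aut_powi: "(\<sigma> ^^ j) (x powi k) = (\<sigma> ^^ j) x powi k"
  by (simp add: power_int_def aut_power aut_inverse)

lemma aut_order_dvd:
  assumes "\<sigma> ^^ D = id" shows "p ^ n dvd D"
proof (cases "D = 0")
  case False
  have id: "\<sigma> ^^ (a * b) = id" if "\<sigma> ^^ a = id" for a b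
    using that by (simp flip: funpow_mult)
  obtain u v where uv: "D * u = p ^ n * v + gcd D (p ^ n)" using bezout_nat[OF False] by blast
  have "\<sigma> ^^ (D * u) = \<sigma> ^^ (p ^ n * v) \<circ> \<sigma> ^^ gcd D (p ^ n)"
    unfolding uv funpow_add ..
  then have g: "\<sigma> ^^ gcd D (p ^ n) = id" using id[OF assms] id[OF ord1] by simp
  obtain i where i: "i \<le> n" "gcd D (p ^ n) = p ^ i"
    using divides_primepow_nat[OF prime_p, of "gcd D (p ^ n)" n] by auto
  have "i = n"
  proof (rule ccontr)
    assume "i \<noteq> n"
    then have "p ^ (n - 1) = p ^ i * p ^ (n - 1 - i)" using i(1) by (simp flip: power_add)
    then show False using id[OF g, of "p ^ (n - 1 - i)"] ord2 i(2) by simp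
  qed
  then show ?thesis using i(2) by (metis gcd_dvd1)
qed simp

text \<open>The Lagrange resolvent y of a suitable t, with the partial norms c of x as coefficients,
  is nonzero by independence of characters. The shift \<open>c_Suc\<close> of the coefficients gives
  x times the conjugate of y equal to y, so the inverse of y is the desired element.\<close>

lemma hilbert90_mult:
  assumes k: "k \<le> n" and x: "x \<noteq> 0" "(\<Prod>j<p ^ (n - k). (\<sigma> ^^ (p ^ k * j)) x) = 1"
  obtains y where "y \<noteq> 0" "x = (\<sigma> ^^ (p ^ k)) y / y"
proof -
  define L where "L = p ^ (n - k)"
  define \<tau> where "\<tau> = (\<lambda>j. \<sigma> ^^ (p ^ k * j))"
  have L: "p ^ k * L = p ^ n" "L > 0"
    using k prime_gt_0_nat[OF prime_p] by (simp_all add: L_def flip: power_add)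
  define c where "c = (\<lambda>j. \<Prod>l<j. \<tau> l x)"
  have dist: "\<tau> i \<noteq> \<tau> j" if "i < j" "j < L" for i j
  proof
    assume eq: "\<tau> i = \<tau> j"
    have "p ^ k * j = p ^ k * i + p ^ k * (j - i)" using that by (simp flip: distrib_left)
    then have "\<tau> j = \<tau> i \<circ> \<sigma> ^^ (p ^ k * (j - i))" unfolding \<tau>_def by (simp only: funpow_add)
    then have "\<tau> i ((\<sigma> ^^ (p ^ k * (j - i))) y) = \<tau> i y" for y using eq by (metis comp_apply)
    then have "\<sigma> ^^ (p ^ k * (j - i)) = id"
      using inj_aut unfolding \<tau>_def by (auto simp: inj_eq fun_eq_iff)
    then have "p ^ n dvd p ^ k * (j - i)" by (rule aut_order_dvd)
    then have "p ^ n \<le> p ^ k * (j - i)"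
      using that prime_gt_0_nat[OF prime_p] by (intro dvd_imp_le) auto
    then have "L \<le> j - i" unfolding L(1)[symmetric] using prime_gt_0_nat[OF prime_p] by simp
    then show False using that by simp
  qed
  obtain t where t: "(\<Sum>j<L. c j * \<tau> j t) \<noteq> 0"
  proof (rule ccontr)
    assume "\<not> thesis"
    then have "\<And>t. (\<Sum>j<L. c j * \<tau> j t) = 0" using that by blast
    then have "c 0 = 0"
      by (intro characters_independent[of \<tau> L c 0]) (auto simp: \<tau>_def aut_mult dist[unfolded \<tau>_def] L)
    then show False by (simp add: c_def)
  qed
  define y where "y = (\<Sum>j<L. c j * \<tau> j t)"
  have tt: "\<tau> 1 (\<tau> j z) = \<tau> (Suc j) z" for j z
    by (simp add: \<tau>_def flip: funpow_add comp_apply[of "_ ^^ _" "_ ^^ _"])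
  have tm: "\<tau> 1 (u * v) = \<tau> 1 u * \<tau> 1 v" for u v by (simp add: \<tau>_def aut_mult)
  have c_Suc: "x * \<tau> 1 (c j) = c (Suc j)" for j
  proof -
    have "\<tau> 1 (c j) = (\<Prod>l<j. \<tau> (Suc l) x)"
      unfolding c_def tt[symmetric] by (simp add: \<tau>_def aut_prod)
    then show ?thesis unfolding c_def prod.lessThan_Suc_shift by (simp add: \<tau>_def)
  qed
  have "x * \<tau> 1 y = (\<Sum>j<L. c (Suc j) * \<tau> (Suc j) t)"
    unfolding c_Suc[symmetric] tt[symmetric]
    by (simp add: y_def sum_distrib_left mult.assoc) (simp add: \<tau>_def aut_sum aut_mult sum_distrib_left)
  moreover have "(\<Sum>j<L. c (Suc j) * \<tau> (Suc j) t) + c 0 * \<tau> 0 t = (\<Sum>j<Suc L. c j * \<tau> j t)"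
    by (simp only: sum.lessThan_Suc_shift add.commute)
  moreover have "c L = 1" using x(2) by (simp add: c_def \<tau>_def L_def)
  moreover have "\<tau> L t = t" by (simp add: \<tau>_def L(1) ord1)
  ultimately have "x * \<tau> 1 y = y" by (simp add: y_def c_def \<tau>_def)
  moreover have y: "y \<noteq> 0" using t by (simp add: y_def)
  moreover have "\<tau> 1 y \<noteq> 0" using y by (simp add: \<tau>_def)
  ultimately have "x = \<tau> 1 (inverse y) / inverse y"
    by (simp only: \<tau>_def aut_inverse) (simp add: field_simps)
  then show thesis using that[of "inverse y"] y by (simp add: \<tau>_def)
qed

lemma xi_neq_0: "\<xi> \<noteq> 0"
  using xi prime_gt_0_nat[OF prime_p] by (auto simp: prim_root_def power_0_left)

lemma Rep_nzmap: "Rep_nonzero (nzmap \<sigma> x) = \<sigma> (Rep_nonzero x)"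
  using aut_eq_0_iff[of 1 "Rep_nonzero x"] by (simp add: nzmap_def)

lemma Rep_nzmap_pow: "Rep_nonzero ((nzmap \<sigma> ^^ j) x) = (\<sigma> ^^ j) (Rep_nonzero x)"
  by (induction j) (simp_all add: Rep_nzmap)

sublocale units: cyclic_module nzpow "nzmap \<sigma>" p n "Abs_nonzero \<xi>"
proof (intro cyclic_module.intro module_nzpow cyclic_module_axioms.intro)
  fix x y :: "'a nonzero"
  show "nzmap \<sigma> (x + y) = nzmap \<sigma> x + nzmap \<sigma> y"
    using aut_mult[of 1] by (simp add: nonzero_eq_iff Rep_nzmap)
  show "nzmap \<sigma> ^^ (p ^ n) = id"
    by (simp add: fun_eq_iff nonzero_eq_iff Rep_nzmap_pow ord1)
  show "nzpow (int p) (Abs_nonzero \<xi>) = 0"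
    using xi xi_neq_0 by (simp add: nonzero_eq_iff prim_root_def)
  show "Abs_nonzero \<xi> \<noteq> 0"
    using xi prime_gt_1_nat[OF prime_p] xi_neq_0
    by (auto simp: nonzero_eq_iff prim_root_def dest!: spec[of _ 1])
  show "nzmap \<sigma> (Abs_nonzero \<xi>) = Abs_nonzero \<xi>"
    using xi_neq_0 by (simp add: nonzero_eq_iff Rep_nzmap xi_fixed)
  show "\<exists>j. x = nzpow j (Abs_nonzero \<xi>)" if "nzpow (int p) x = 0"
  proof -
    have "Rep_nonzero x ^ p = 1" using that by (simp add: nonzero_eq_iff)
    then obtain j where "Rep_nonzero x = \<xi> ^ j"
      using prim_root_generates[OF xi prime_gt_0_nat[OF prime_p]] by blast
    then show ?thesis using xi_neq_0 by (intro exI[of _ "int j"]) (simp add: nonzero_eq_iff)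
  qed
  show "\<exists>y. x = (nzmap \<sigma> ^^ (p ^ k)) y - y"
    if k: "k \<le> n" and s: "(\<Sum>j<p ^ (n - k). (nzmap \<sigma> ^^ (p ^ k * j)) x) = 0" for k
  proof -
    have "(\<Prod>j<p ^ (n - k). (\<sigma> ^^ (p ^ k * j)) (Rep_nonzero x)) = 1"
      using s by (simp add: nonzero_eq_iff Rep_nzmap_pow)
    then obtain y where "y \<noteq> 0" "Rep_nonzero x = (\<sigma> ^^ (p ^ k)) y / y"
      using hilbert90_mult[OF k] by (metis Rep_nonzero_neq_0)
    then show ?thesis
      by (intro exI[of _ "Abs_nonzero y"]) (simp add: nonzero_eq_iff Rep_nzmap_pow)
  qed
qed (use prime_p n_pos in auto)

lemma fixd_iff: "x \<in> units.fixd (p ^ k) \<longleftrightarrow> Rep_nonzero x \<in> Kfix \<sigma> p k"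
  by (simp add: units.fixd_def Kfix_def nonzero_eq_iff Rep_nzmap_pow)

lemma Rep_nrm: "Rep_nonzero (units.nrm (p ^ k) x) = normK \<sigma> p k (Rep_nonzero x)"
  by (simp add: units.nrm_def normK_def Rep_nzmap_pow)

lemma norm_pair_iff_add: "norm_pair \<sigma> p n \<xi> m a d \<longleftrightarrow> units.add_norm_pair m a d"
proof
  assume L: "norm_pair \<sigma> p n \<xi> m a d"
  then obtain \<alpha> \<delta> where *: "\<alpha> \<noteq> 0" "\<delta> m \<noteq> 0"
      "\<forall>i<m. case a ! i of None \<Rightarrow> \<delta> i = 1 | Some k \<Rightarrow> \<delta> i \<noteq> 0 \<and> \<delta> i \<in> Kfix \<sigma> p k"
      "\<sigma> \<alpha> = \<alpha> powi d * (\<Prod>i\<le>m. \<delta> i ^ (p ^ i))"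
      "\<xi> = normK \<sigma> p n \<alpha> powi ((d - 1) div int p) * normK \<sigma> p (n - 1) (\<delta> 0)
             * (\<Prod>i\<in>{1..m}. normK \<sigma> p n (\<delta> i) ^ (p ^ (i - 1)))"
    unfolding norm_pair_def by blast
  have nz: "\<delta> i \<noteq> 0" if "i \<le> m" for i
    using *(2) *(3)[rule_format, of i] that by (cases "i = m") (auto split: option.splits)
  define \<delta>' where "\<delta>' = (\<lambda>i. Abs_nonzero (\<delta> i))"
  have R: "Rep_nonzero (\<delta>' i) = \<delta> i" if "i \<le> m" for i using nz[OF that] by (simp add: \<delta>'_def)
  have "units.has_levels m a \<delta>'"
    unfolding units.has_levels_def using *(3) R by (auto split: option.splits simp: nonzero_eq_iff fixd_iff)
  moreover have "nzmap \<sigma> (Abs_nonzero \<alpha>) = nzpow d (Abs_nonzero \<alpha>) + units.wsum m \<delta>'"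
    by (simp add: nonzero_eq_iff Rep_nzmap units.wsum_def *(1,4) R flip: of_nat_power)
  moreover have "Abs_nonzero \<xi> = nzpow ((d - 1) div int p) (units.nrm (p ^ n) (Abs_nonzero \<alpha>))
      + units.nrm (p ^ (n - 1)) (\<delta>' 0)
      + (\<Sum>i\<in>{1..m}. nzpow (int p ^ (i - 1)) (units.nrm (p ^ n) (\<delta>' i)))"
    unfolding nonzero_eq_iff using xi_neq_0
    by (simp add: Rep_nrm *(1) R flip: of_nat_power) (subst *(5), simp)
  moreover have "units.admissible_vec m a" "[d = 1] (mod int p)"
    using L unfolding norm_pair_def units.admissible_vec_def by (auto split: option.splits)
  ultimately show "units.add_norm_pair m a d" unfolding units.add_norm_pair_def by blast
next
  assume R: "units.add_norm_pair m a d"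
  then obtain \<alpha> \<delta> where *: "units.has_levels m a \<delta>"
      "nzmap \<sigma> \<alpha> = nzpow d \<alpha> + units.wsum m \<delta>"
      "Abs_nonzero \<xi> = nzpow ((d - 1) div int p) (units.nrm (p ^ n) \<alpha>)
      + units.nrm (p ^ (n - 1)) (\<delta> 0)
      + (\<Sum>i\<in>{1..m}. nzpow (int p ^ (i - 1)) (units.nrm (p ^ n) (\<delta> i)))"
    unfolding units.add_norm_pair_def by blast
  let ?\<alpha> = "Rep_nonzero \<alpha>" and ?\<delta> = "\<lambda>i. Rep_nonzero (\<delta> i)"
  have "\<forall>i<m. case a ! i of None \<Rightarrow> ?\<delta> i = 1 | Some k \<Rightarrow> ?\<delta> i \<noteq> 0 \<and> ?\<delta> i \<in> Kfix \<sigma> p k"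
    using *(1) unfolding units.has_levels_def by (auto split: option.splits simp: nonzero_eq_iff fixd_iff)
  moreover have "\<sigma> ?\<alpha> = ?\<alpha> powi d * (\<Prod>i\<le>m. ?\<delta> i ^ (p ^ i))"
    using *(2) by (simp add: nonzero_eq_iff Rep_nzmap units.wsum_def flip: of_nat_power)
  moreover have "\<xi> = normK \<sigma> p n ?\<alpha> powi ((d - 1) div int p) * normK \<sigma> p (n - 1) (?\<delta> 0)
             * (\<Prod>i\<in>{1..m}. normK \<sigma> p n (?\<delta> i) ^ (p ^ (i - 1)))"
    using *(3) xi_neq_0 unfolding nonzero_eq_iff by (simp add: Rep_nrm flip: of_nat_power)
  moreover have "?\<alpha> \<noteq> 0" "?\<delta> m \<noteq> 0" by simp_all
  moreover have "m \<ge> 1" "length a = m" "\<forall>i<m. case a ! i of None \<Rightarrow> True | Some k \<Rightarrow> k \<le> n"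
      "case a ! 0 of None \<Rightarrow> True | Some k \<Rightarrow> k < n" "[d = 1] (mod int p)"
    using R unfolding units.add_norm_pair_def units.admissible_vec_def by (auto split: option.splits)
  ultimately show "norm_pair \<sigma> p n \<xi> m a d" unfolding norm_pair_def
    by (intro conjI exI[of _ ?\<alpha>] exI[of _ ?\<delta>]) assumption+
qed

end

section \<open>Cyclotomic exponents and comparison of pairs\<close>

lemma tval_cong:
  assumes "prime p" "\<And>j. j \<le> m \<Longrightarrow> int p ^ j dvd x \<longleftrightarrow> int p ^ j dvd y"
  shows "tval p m x = tval p m y"
  by (intro order_antisym) (use assms(2) le_tval_iff[OF assms(1)] in blast)+

lemma dvd_iff_of_cong:
  fixes q x y :: int
  assumes "[x = y] (mod q ^ v)" "j \<le> v"
  shows "q ^ j dvd x - z \<longleftrightarrow> q ^ j dvd y - z"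
proof -
  have "[x = y] (mod q ^ j)" using assms by (meson cong_dvd_modulus le_imp_power_dvd)
  then have "[x - z = y - z] (mod q ^ j)" by (intro cong_diff) simp_all
  then show ?thesis by (rule cong_dvd_iff)
qed

context cyclic_extension
begin

lemma p_pos: "p > 0" "p > 1"
  using prime_gt_0_nat[OF prime_p] prime_gt_1_nat[OF prime_p] by auto

abbreviation "F \<equiv> {x. \<sigma> x = x}"

lemma F_closed: "1 \<in> F" "x \<in> F \<Longrightarrow> x ^ k \<in> F"
  using aut_1[of 1] aut_power[of 1 x k] by auto

lemma has_roots_mono:
  assumes "has_roots S p k" "i \<le> k" "\<And>x j. x \<in> S \<Longrightarrow> x ^ j \<in> S"
  shows "has_roots S p i"
  using assms prim_root_power[OF _ assms(2) p_pos(1)] unfolding has_roots_def by blast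

lemma has_roots_0: "1 \<in> S \<Longrightarrow> has_roots S p 0"
  unfolding has_roots_def prim_root_def by (intro bexI[of _ 1]) auto

lemma le_root_level_F_iff: "enat k \<le> root_level F p \<longleftrightarrow> has_roots F p k"
  by (intro le_root_level_iff has_roots_0 F_closed) (auto intro: has_roots_mono F_closed(2)[simplified])

lemma le_root_level_UNIV_iff: "enat k \<le> root_level (UNIV :: 'a set) p \<longleftrightarrow> has_roots (UNIV :: 'a set) p k"
  by (intro le_root_level_iff has_roots_0) (auto intro: has_roots_mono)

lemma has_roots_F_1: "has_roots F p 1"
  using xi xi_fixed by (auto simp: has_roots_def)

lemma roots_in_F:
  assumes "has_roots F p k" "x ^ (p ^ k) = 1" shows "\<sigma> x = x"
proof -
  obtain \<eta> where \<eta>: "\<sigma> \<eta> = \<eta>" "prim_root \<eta> (p ^ k)" using assms(1) by (auto simp: has_roots_def)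
  obtain j where "x = \<eta> ^ j" using prim_root_generates[OF \<eta>(2) _ assms(2)] p_pos by auto
  then show ?thesis using F_closed(2)[of \<eta> j] \<eta>(1) by simp
qed

text \<open>\<sigma> fixes the p^f-th roots of unity, so c acts on them like 1. With f = 1 this
  yields c = 1 modulo p, and with f = 2 and p = 2 the congruence modulo 4.\<close>

lemma cyc_exponent_cong:
  assumes z: "prim_root \<zeta> (p ^ e)" "\<sigma> \<zeta> = \<zeta> powi c" and f: "has_roots F p f" "f \<le> e"
  shows "[c = 1] (mod int p ^ f)"
proof -
  have z0: "\<zeta> \<noteq> 0" using z(1) p_pos by (auto simp: prim_root_def power_0_left)
  let ?q = "p ^ (e - f)"
  have "prim_root (\<zeta> ^ ?q) (p ^ f)" by (rule prim_root_power[OF z(1) f(2) p_pos(1)])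
  then have "\<sigma> (\<zeta> ^ ?q) = \<zeta> ^ ?q" by (intro roots_in_F[OF f(1)]) (simp add: prim_root_def)
  moreover have "\<sigma> (\<zeta> ^ ?q) = \<zeta> powi (c * int ?q)"
    using aut_power[of 1 \<zeta> ?q] z(2) by (simp only: power_int_mult power_int_of_nat) simp
  ultimately have "\<zeta> powi (c * int ?q) = \<zeta> powi int ?q"
    by (simp only: power_int_of_nat)
  then have "\<zeta> powi (c * int ?q - int ?q) = 1" using z0 by (simp add: power_int_diff)
  then have "int (p ^ e) dvd c * int ?q - int ?q"
    using prim_root_power_eq_1_iff[OF z(1)] p_pos by simp
  moreover have "int (p ^ e) = int p ^ f * int ?q" using f(2) by (simp flip: power_add)
  ultimately have "int p ^ f * int ?q dvd (c - 1) * int ?q" by (simp add: left_diff_distrib)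
  then have "int p ^ f dvd c - 1" using p_pos by simp
  then show ?thesis by (simp add: cong_iff_dvd_diff)
qed

lemma cyc_char_congI:
  assumes z: "prim_root \<zeta> (p ^ e)" "\<sigma> \<zeta> = \<zeta> powi c"
  shows "cyc_char_cong \<sigma> p e c"
  unfolding cyc_char_cong_def
proof (intro allI impI)
  fix x :: 'a assume "x ^ (p ^ e) = 1"
  then obtain j where "x = \<zeta> ^ j" using prim_root_generates[OF z(1)] p_pos by auto
  then show "\<sigma> x = x powi c"
    using aut_power[of 1 \<zeta> j] z(2) by (simp flip: power_int_of_nat power_int_mult add: mult.commute)
qed

lemma cyc_char_cong_mod:
  assumes "cyc_char_cong \<sigma> p e c" "int p ^ e dvd d - c"
  shows "cyc_char_cong \<sigma> p e d"
  unfolding cyc_char_cong_def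
proof (intro allI impI)
  fix x :: 'a assume x: "x ^ (p ^ e) = 1"
  then have x0: "x \<noteq> 0" using p_pos by (auto simp: power_0_left)
  obtain q where "d - c = int (p ^ e) * q" using assms(2) by (auto simp: dvd_def)
  then have "d = c + int (p ^ e) * q" by simp
  then have "x powi d = x powi c * (x powi int (p ^ e)) powi q"
    using x0 by (simp only: power_int_add power_int_mult simp_thms)
  then show "\<sigma> x = x powi d"
    using assms(1) x unfolding cyc_char_cong_def by (simp only: power_int_of_nat) simp
qed

lemma torsion_iff: "nzpow (int p ^ k) x = 0 \<longleftrightarrow> Rep_nonzero x ^ (p ^ k) = 1"
  by (simp add: nonzero_eq_iff flip: of_nat_power)

lemma nzmap_eq_nzpow:
  assumes "cyc_char_cong \<sigma> p e c" "nzpow (int p ^ e) x = 0"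
  shows "nzmap \<sigma> x = nzpow c x"
  using assms(1) assms(2)[unfolded torsion_iff]
  by (simp add: cyc_char_cong_def nonzero_eq_iff Rep_nzmap)

lemma norm_pair_cyc_char_cong:
  assumes a: "units.tame a" and np: "norm_pair \<sigma> p n \<xi> m a d"
    and least: "\<And>a' d'. norm_pair \<sigma> p n \<xi> m a' d' \<Longrightarrow> \<not> lex_less a' a"
    and e: "e \<le> m" "has_roots (UNIV :: 'a set) p e" and two: "p = 2 \<Longrightarrow> e \<ge> 2 \<Longrightarrow> has_roots F p 2"
  shows "cyc_char_cong \<sigma> p e d"
\<comment> \<open>For e at most 1 the roots in question lie in F, and d = 1 modulo p is enough. The
  congruence modulo 4 for p = 2 is available from e = 2 on.\<close>
proof (cases "e \<ge> 2")
  case False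
  have d: "[d = 1] (mod int p)" using np by (simp add: norm_pair_def)
  have "has_roots F p e"
    using has_roots_mono[OF has_roots_F_1, of e] F_closed(2) False by simp
  then have "cyc_char_cong \<sigma> p e 1"
    unfolding cyc_char_cong_def using roots_in_F by simp
  moreover have "int p ^ e dvd d - 1"
  proof (cases "e = 0")
    case False
    then have "e = 1" using \<open>\<not> e \<ge> 2\<close> by simp
    then show ?thesis using d by (simp add: cong_iff_dvd_diff)
  qed simp
  ultimately show ?thesis by (rule cyc_char_cong_mod)
next
  case True
  obtain \<zeta> :: 'a where z: "prim_root \<zeta> (p ^ e)" using e(2) by (auto simp: has_roots_def)
  have "\<sigma> \<zeta> ^ (p ^ e) = 1" using aut_power[of 1 \<zeta> "p ^ e"] aut_1[of 1] z by (simp add: prim_root_def)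
  then obtain j where j: "\<sigma> \<zeta> = \<zeta> ^ j" using prim_root_generates[OF z] p_pos by auto
  define c where "c = int j"
  have sz: "\<sigma> \<zeta> = \<zeta> powi c" by (simp add: j c_def)
  have cyc: "cyc_char_cong \<sigma> p e c" by (rule cyc_char_congI[OF z sz])
  have c1: "[c = 1] (mod int p)" using cyc_exponent_cong[OF z sz has_roots_F_1] True by simp
  have c2: "p = 2 \<Longrightarrow> [c = 1] (mod 4)" using cyc_exponent_cong[OF z sz two True] True by simp
  have "(\<sigma> ^^ i) \<zeta> = \<zeta> powi (c ^ i)" for i
  proof (induction i)
    case (Suc i)
    then show ?case using aut_powi[of 1 \<zeta> "c ^ i"] sz by (simp flip: power_int_mult)
  qed simp
  from this[of "p ^ n"] have "\<zeta> powi (c ^ p ^ n) = \<zeta>" by (simp add: ord1)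
  moreover have "\<zeta> \<noteq> 0" using z p_pos by (auto simp: prim_root_def power_0_left)
  ultimately have "\<zeta> powi (c ^ p ^ n - 1) = 1" by (simp add: power_int_diff)
  then have cn: "int p ^ e dvd c ^ p ^ n - 1" using prim_root_power_eq_1_iff[OF z] p_pos by simp
  have root: "\<exists>y. x = nzpow (int p) y" if M: "M < e" and x: "nzpow (int p ^ M) x = 0" for M and x :: "'a nonzero"
  proof -
    have "prim_root (\<zeta> ^ p ^ (e - M)) (p ^ M)" using M p_pos by (intro prim_root_power[OF z]) auto
    moreover have "Rep_nonzero x ^ (p ^ M) = 1" using x by (simp add: torsion_iff)
    ultimately obtain i where i: "Rep_nonzero x = (\<zeta> ^ p ^ (e - M)) ^ i"
      using prim_root_generates p_pos by (metis zero_less_power)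
    have e: "p ^ (e - M) * i = p ^ (e - Suc M) * i * p"
      using M by (metis Suc_diff_Suc mult.assoc mult.commute power_Suc)
    then have "Rep_nonzero x = (\<zeta> ^ (p ^ (e - Suc M) * i)) ^ p"
      by (simp only: i power_mult[symmetric] e)
    then show ?thesis using \<open>\<zeta> \<noteq> 0\<close>
      by (intro exI[of _ "Abs_nonzero (\<zeta> ^ (p ^ (e - Suc M) * i))"]) (simp add: nonzero_eq_iff)
  qed
  have "int p ^ e dvd d - c"
    by (rule units.add_norm_pair_cyclotomic_cong[OF a np[unfolded norm_pair_iff_add] least[unfolded norm_pair_iff_add]
          c1 c2 e(1) cn nzmap_eq_nzpow[OF cyc] root])
  with cyc show ?thesis by (rule cyc_char_cong_mod)
qed

lemma norm_pair_of_cyc_char: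
  assumes a: "units.tame a" and np: "norm_pair \<sigma> p n \<xi> m a d"
    and c: "[c = 1] (mod int p)" "p = 2 \<Longrightarrow> [c = 1] (mod 4)" "cyc_char_cong \<sigma> p m c"
  shows "norm_pair \<sigma> p n \<xi> m a c"
  using units.add_norm_pair_cyclotomic[OF a np[unfolded norm_pair_iff_add] c(1,2) nzmap_eq_nzpow[OF c(3)]]
  by (simp add: norm_pair_iff_add)

text \<open>The square of x has norm 1, so it equals \<open>\<sigma> y / y\<close>. Taking y for
  \<alpha>, x for \<open>\<delta> 1\<close> and 1 for d, the second condition becomes \<xi> = N(x) =
  -1. As this vector starts with \<open>None\<close>, so does every minimal one, which makes it
  \<open>tame\<close>.\<close>

lemma quadratic_norm_pair:
  assumes p2: "p = 2" "n = 1" and x: "x \<noteq> 0" "normK \<sigma> p n x = -1" and m: "m \<ge> 1"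
  shows "norm_pair \<sigma> p n \<xi> m (None # replicate (m - 1) (Some 1)) 1"
proof -
  have "\<xi> ^ 2 = 1" "\<xi> \<noteq> 1" using xi p2 by (auto simp: prim_root_def dest!: spec[of _ 1])
  then have xi1: "\<xi> = -1" using power2_eq_1_iff[of \<xi>] by simp
  have N: "x * \<sigma> x = -1" using x(2) p2 by (simp add: normK_def numeral_2_eq_2)
  have "(\<Prod>j<p ^ (n - 0). (\<sigma> ^^ (p ^ 0 * j)) (x ^ 2)) = (x * \<sigma> x) ^ 2"
    using aut_power[of 1 x 2] p2 by (simp add: numeral_2_eq_2 mult_ac)
  then have "(\<Prod>j<p ^ (n - 0). (\<sigma> ^^ (p ^ 0 * j)) (x ^ 2)) = 1" using N by simp
  then obtain y where y: "y \<noteq> 0" "x ^ 2 = \<sigma> y / y"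
    using hilbert90_mult[of 0 "x ^ 2"] x(1) by auto
  define \<delta> where "\<delta> = (\<lambda>i::nat. if i = 1 then x else 1)"
  let ?a = "None # replicate (m - 1) (Some (1::nat))"
  have an: "?a ! i = (if i = 0 then None else Some 1)" if "i < m" for i
    using that by (cases i) auto
  have top: "z \<in> Kfix \<sigma> p 1" for z using ord1 p2 by (simp add: Kfix_def)
  have n1: "normK \<sigma> p k 1 = 1" for k by (simp add: normK_def)
  have "(\<Prod>i\<le>m. \<delta> i ^ (p ^ i)) = (\<Prod>i\<in>{1}. \<delta> i ^ (p ^ i))"
    using m by (intro prod.mono_neutral_right) (auto simp: \<delta>_def)
  then have 1: "(\<Prod>i\<le>m. \<delta> i ^ (p ^ i)) = x ^ 2" using p2 by (simp add: \<delta>_def)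
  have "(\<Prod>i\<in>{1..m}. normK \<sigma> p n (\<delta> i) ^ (p ^ (i - 1))) = (\<Prod>i\<in>{1}. normK \<sigma> p n (\<delta> i) ^ (p ^ (i - 1)))"
    using m by (intro prod.mono_neutral_right) (auto simp: \<delta>_def n1)
  then have 2: "(\<Prod>i\<in>{1..m}. normK \<sigma> p n (\<delta> i) ^ (p ^ (i - 1))) = -1" using x(2) by (simp add: \<delta>_def)
  have 3: "normK \<sigma> p (n - 1) (\<delta> 0) = 1" by (simp add: \<delta>_def n1)
  show ?thesis
    unfolding norm_pair_def
  proof (intro conjI exI[of _ y] exI[of _ \<delta>])
    show "\<sigma> y = y powi 1 * (\<Prod>i\<le>m. \<delta> i ^ (p ^ i))" unfolding 1 using y by simp
    show "\<xi> = normK \<sigma> p n y powi ((1 - 1) div int p) * normK \<sigma> p (n - 1) (\<delta> 0)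
             * (\<Prod>i\<in>{1..m}. normK \<sigma> p n (\<delta> i) ^ (p ^ (i - 1)))"
      unfolding 2 3 xi1 by simp
    show "\<forall>i<m. case ?a ! i of None \<Rightarrow> \<delta> i = 1 | Some k \<Rightarrow> \<delta> i \<noteq> 0 \<and> \<delta> i \<in> Kfix \<sigma> p k"
      using x(1) top an by (auto simp: \<delta>_def)
    show "\<forall>i<m. case ?a ! i of None \<Rightarrow> True | Some k \<Rightarrow> k \<le> n" using p2 an by auto
  qed (use m y x in \<open>auto simp: \<delta>_def\<close>)
qed

end

theorem theorem1:
  fixes \<sigma> :: "'a::field \<Rightarrow> 'a" and p n m :: nat and \<xi> :: 'a
    and a :: "nat option list" and d :: int
  defines "F \<equiv> {x. \<sigma> x = x}"
  defines "\<omega> \<equiv> root_level F p"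
  defines "\<nu> \<equiv> root_level (UNIV :: 'a set) p"
  assumes p: "prime p" and n: "n \<ge> 1"
    and char: "of_nat p \<noteq> (0::'a)"
    and aut: "field_aut \<sigma>"
    and ord1: "\<sigma> ^^ (p ^ n) = id" and ord2: "\<sigma> ^^ (p ^ (n - 1)) \<noteq> id"
    and xi: "prim_root \<xi> p" and xiF: "\<xi> \<in> F"
    and minus1: "p = 2 \<and> n = 1 \<longrightarrow> (\<exists>x. x \<noteq> 0 \<and> normK \<sigma> p n x = -1)"
    and exc: "\<not> (p = 2 \<and> \<omega> = 1 \<and> 1 < \<nu>)"
    and m: "m \<ge> 1"
    and min: "minimal_norm_pair \<sigma> p n \<xi> m a d"
  shows "(\<omega> < \<nu> \<longrightarrow> (\<forall>d'::int. (case \<nu> of enat v \<Rightarrow> [d' = d] (mod int p ^ v) | \<infinity> \<Rightarrow> d' = d)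
                            \<longrightarrow> minimal_norm_pair \<sigma> p n \<xi> m a d'))
       \<and> (\<omega> = \<nu> \<longrightarrow> [d = 1] (mod int p ^ m))
       \<and> cyc_char_cong \<sigma> p (case \<nu> of enat v \<Rightarrow> min m v | \<infinity> \<Rightarrow> m) d"
proof -
  interpret cyclic_extension \<sigma> p n \<xi>
    by unfold_locales (use p n aut ord1 ord2 xi xiF in \<open>auto simp: F_def\<close>)
  have np: "norm_pair \<sigma> p n \<xi> m a d" and le: "\<And>a' d'. norm_pair \<sigma> p n \<xi> m a' d' \<Longrightarrow> pair_le p m a d a' d'"
    using min by (auto simp: minimal_norm_pair_def)
  have least: "\<not> lex_less a' a" if "norm_pair \<sigma> p n \<xi> m a' d'" for a' d'
    using le[OF that] lex_less_asym[of a a'] lex_less_asym[of a a] by (auto simp: pair_le_def)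
  have len: "length a = m" and d1: "[d = 1] (mod int p)" using np by (auto simp: norm_pair_def)
  have tame: "units.tame a"
  proof (cases "odd p \<or> n \<ge> 2")
    case False
    then have p2: "p = 2" "n = 1" using p n prime_odd_nat p_pos(2) by force+
    then obtain x where "x \<noteq> 0" "normK \<sigma> p n x = -1" using minus1 by blast
    then have "\<not> lex_less (None # replicate (m - 1) (Some 1)) a"
      using least[OF quadratic_norm_pair[OF p2 _ _ m]] by blast
    then have "\<not> olt None (a ! 0)"
      using len m unfolding lex_less_def by (auto dest!: spec[of _ 0])
    then show ?thesis by (cases "a ! 0") (auto simp: units.tame_def)
  qed (auto simp: units.tame_def)
  have lF: "enat k \<le> \<omega> \<longleftrightarrow> has_roots {x. \<sigma> x = x} p k" for k
    unfolding \<omega>_def F_def by (rule le_root_level_F_iff)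
  have lK: "enat k \<le> \<nu> \<longleftrightarrow> has_roots (UNIV :: 'a set) p k" for k
    unfolding \<nu>_def by (rule le_root_level_UNIV_iff)
  have w1: "1 \<le> \<omega>" using lF[of 1] has_roots_F_1 by (simp add: one_enat_def)
  have two: "has_roots {x. \<sigma> x = x} p 2" if "p = 2" "1 < \<nu>"
  proof -
    have "\<omega> \<noteq> 1" using exc that by blast
    then have "1 < \<omega>" using w1 by simp
    then have "enat 2 \<le> \<omega>" by (cases \<omega>) (auto simp: one_enat_def)
    then show ?thesis using lF by blast
  qed
  have char_cong: "cyc_char_cong \<sigma> p e d" if "e \<le> m" "enat e \<le> \<nu>" for e
  proof (rule norm_pair_cyc_char_cong[OF tame np least that(1)])
    show "has_roots (UNIV :: 'a set) p e" using that(2) lK by blast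
    assume "p = 2" "e \<ge> 2"
    then have "1 < enat e" by (simp add: one_enat_def)
    then show "has_roots {x. \<sigma> x = x} p 2" using two \<open>p = 2\<close> that(2) by (meson less_le_trans)
  qed
  have part3: "cyc_char_cong \<sigma> p (case \<nu> of enat v \<Rightarrow> min m v | \<infinity> \<Rightarrow> m) d"
    by (cases \<nu>) (auto intro!: char_cong)
  have part2: "[d = 1] (mod int p ^ m)" if "\<omega> = \<nu>"
  proof -
    have "\<sigma> x = x" if "x ^ (p ^ m) = 1" for x
    proof -
      obtain k where "prim_root x (p ^ k)" using prim_root_exists_order[OF p \<open>x ^ (p ^ m) = 1\<close>] by blast
      moreover from this have "has_roots (UNIV :: 'a set) p k" by (auto simp: has_roots_def)
      then have "has_roots {x. \<sigma> x = x} p k" using lF lK \<open>\<omega> = \<nu>\<close> by blast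
      ultimately show ?thesis using roots_in_F by (auto simp: prim_root_def)
    qed
    \<comment> \<open>All p-power roots of unity of K lie in F, hence 1 is a cyclotomic exponent.
      Comparison with this pair, whose truncated valuation is the maximal value m, forces the same
      value for d.\<close>
    then have "norm_pair \<sigma> p n \<xi> m a 1"
      by (intro norm_pair_of_cyc_char[OF tame np]) (auto simp: cyc_char_cong_def)
    from le[OF this] have "tval p m 0 \<le> tval p m (d - 1)"
      using lex_less_asym[of a a] by (auto simp: pair_le_def)
    then have "m \<le> tval p m (d - 1)" by (simp add: tval_def)
    then show ?thesis using le_tval_iff[OF p] by (simp add: cong_iff_dvd_diff)
  qed
  have part1: "minimal_norm_pair \<sigma> p n \<xi> m a d'"
    if wv: "\<omega> < \<nu>" and d': "case \<nu> of enat v \<Rightarrow> [d' = d] (mod int p ^ v) | \<infinity> \<Rightarrow> d' = d" for d'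
  proof (cases \<nu>)
    case infinity
    then show ?thesis using d' min by simp
  next
    case (enat v)
    then have dd: "[d' = d] (mod int p ^ v)" using d' by simp
    have same: "int p ^ j dvd d' - 1 \<longleftrightarrow> int p ^ j dvd d - 1" if "j \<le> v" for j
      using dvd_iff_of_cong[OF dd that] .
    have "norm_pair \<sigma> p n \<xi> m a d' \<and> tval p m (d' - 1) = tval p m (d - 1)"
    proof (cases "m \<le> v")
      case True
      have "int p ^ m dvd d - d'"
        using dvd_iff_of_cong[OF dd True, of d'] by simp
      then have "norm_pair \<sigma> p n \<xi> m a d'"
        using units.add_norm_pair_shift_top[OF tame np[unfolded norm_pair_iff_add]] by (simp add: norm_pair_iff_add)
      moreover have "tval p m (d' - 1) = tval p m (d - 1)"
        by (rule tval_cong[OF p same]) (use True in simp)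
      ultimately show ?thesis by blast
    next
      case False
      have vv: "enat v \<le> \<nu>" by (simp add: enat)
      have cyc: "cyc_char_cong \<sigma> p v d" using char_cong[OF _ vv] False by simp
      obtain \<zeta> :: 'a where z: "prim_root \<zeta> (p ^ v)" using lK[of v] vv by (auto simp: has_roots_def)
      have sz: "\<sigma> \<zeta> = \<zeta> powi d" using cyc z by (auto simp: cyc_char_cong_def prim_root_def)
      have v2: "v \<ge> 2"
        using w1 wv enat by (cases \<omega>) (auto simp: one_enat_def)
      have "int p dvd d' - 1" using same[of 1] v2 d1 by (simp add: cong_iff_dvd_diff)
      then have c1: "[d' = 1] (mod int p)" by (simp add: cong_iff_dvd_diff)
      have c2: "[d' = 1] (mod 4)" if "p = 2"
      proof -
        have "1 < \<nu>" using v2 by (simp add: enat one_enat_def)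
        then have "[d = 1] (mod int p ^ 2)" using cyc_exponent_cong[OF z sz two[OF that] v2] by blast
        then show ?thesis using same[OF v2] that by (simp add: cong_iff_dvd_diff)
      qed
      have cyc': "cyc_char_cong \<sigma> p v d'"
        by (rule cyc_char_cong_mod[OF cyc]) (use dd in \<open>simp add: cong_iff_dvd_diff\<close>)
      \<comment> \<open>As \<nu> = v is less than m, the p^m-th roots of unity in K are already
        p^v-th roots, and there d' acts like d.\<close>
      have "cyc_char_cong \<sigma> p m d'" unfolding cyc_char_cong_def
      proof (intro allI impI)
        fix x :: 'a assume "x ^ (p ^ m) = 1"
        then obtain k where k: "prim_root x (p ^ k)" using prim_root_exists_order[OF p] by blast
        then have "enat k \<le> \<nu>" using lK by (auto simp: has_roots_def)
        then have "p ^ v = p ^ k * p ^ (v - k)" by (simp add: enat flip: power_add)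
        then have "x ^ (p ^ v) = 1" using k by (simp add: prim_root_def power_mult)
        then show "\<sigma> x = x powi d'" using cyc' by (simp add: cyc_char_cong_def)
      qed
      then have "norm_pair \<sigma> p n \<xi> m a d'" by (intro norm_pair_of_cyc_char[OF tame np c1 c2])
      \<comment> \<open>Since \<omega> < v, \<sigma> moves \<zeta>; so the valuation of d - 1 is
        less than v and survives a change of d modulo p^v.\<close>
      moreover have nd: "\<not> int p ^ v dvd d - 1"
      proof
        assume "int p ^ v dvd d - 1"
        then have "\<zeta> powi (d - 1) = 1" using prim_root_power_eq_1_iff[OF z] p_pos by simp
        moreover have "\<zeta> \<noteq> 0" using z p_pos by (auto simp: prim_root_def power_0_left)
        ultimately have "\<sigma> \<zeta> = \<zeta>" using sz by (simp add: power_int_diff)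
        then have "enat v \<le> \<omega>" using z lF by (auto simp: has_roots_def)
        then show False using wv enat by simp
      qed
      have "int p ^ j dvd d' - 1 \<longleftrightarrow> int p ^ j dvd d - 1" for j
      proof (cases "j \<le> v")
        case False
        then have "int p ^ v dvd int p ^ j" by (simp add: le_imp_power_dvd)
        then show ?thesis using nd same[of v] by (meson dvd_trans order_refl)
      qed (rule same)
      then have "tval p m (d' - 1) = tval p m (d - 1)" using tval_cong[OF p] by blast
      ultimately show ?thesis by blast
    qed
    then show ?thesis using le unfolding minimal_norm_pair_def pair_le_def by auto
  qed
  show ?thesis using part1 part2 part3 by blast
qed

end
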